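(* Let $k$ be an algebraically closed field of arbitrary characteristic and let $\mathfrak{a}\subset k[[x,y]]$ be an ideal. Let $\Xi$ be the set of pairs $\varphi=(\varphi_1,\varphi_2)\in k[[t]]^2$ with $\varphi\neq(0,0)$ and $\varphi(0)=(0,0)$, and let $$\mathfrak{L}(\mathfrak{a}):=\sup_{\varphi\in\Xi}\left(\inf_{f\in\mathfrak{a}}\frac{\operatorname{ord}(f\circ\varphi)}{\operatorname{ord}\varphi}\right).$$ Then $$\mathfrak{L}(\mathfrak{a})=\inf\left\{\frac{p}{q}\;:\;p,q \text{ positive integers},\ (x,y)^{p}\,k[[x,y]]\subset\overline{\mathfrak{a}^{q}}\right\},$$ where both sides are regarded as elements of $[0,+\infty]$.
   Context: For a power series $g\in k[[t]]$, $\operatorname{ord} g$ is its order (the lowest exponent of $t$ occurring with nonzero coefficient), with $\operatorname{ord}0=+\infty$; for $\varphi=(\varphi_1,\varphi_2)$, $\operatorname{ord}\varphi=\min(\operatorname{ord}\varphi_1,\operatorname{ord}\varphi_2)$. The composition $f\circ\varphi=f(\varphi_1(t),\varphi_2(t))$ is substitution. The infimum of the empty set is $+\infty$. For an ideal $\mathfrak{b}$ in a commutative ring $R$, the integral closure $\overline{\mathfrak{b}}$ is the set of $z\in R$ for which there are $N\geq1$ and $b_j\in\mathfrak{b}^j$ ($j=1,\dots,N$) with $z^N+b_1z^{N-1}+\cdots+b_N=0$. *)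

theory Defs
  imports
    "HOL-Computational_Algebra.Computational_Algebra"
    "HOL-Library.Extended_Nonnegative_Real"
begin

text \<open>
  Ideals of a commutative ring, given as a type, are its submodules as a module over itself.
\<close>

lemma module_times: "module ((*) :: 'a::comm_ring_1 \<Rightarrow> 'a \<Rightarrow> 'a)"
  by unfold_locales (simp_all add: algebra_simps)

definition is_ideal :: "'a::comm_ring_1 set \<Rightarrow> bool" where
  "is_ideal I \<longleftrightarrow> module.subspace (*) I"

definition ideal_gen :: "'a::comm_ring_1 set \<Rightarrow> 'a set" where
  "ideal_gen S = module.span (*) S"

lemma is_ideal_iff:
  "is_ideal I \<longleftrightarrow>
     0 \<in> I \<and> (\<forall>x\<in>I. \<forall>y\<in>I. x + y \<in> I) \<and> (\<forall>r. \<forall>x\<in>I. r * x \<in> I)"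
  unfolding is_ideal_def by (rule module.subspace_def[OF module_times])

lemma ideal_gen_eq_Inter: "ideal_gen S = \<Inter>{I. is_ideal I \<and> S \<subseteq> I}"
  unfolding ideal_gen_def is_ideal_def
  by (auto simp: module.span_def[OF module_times] hull_def)

fun ideal_power :: "'a::comm_ring_1 set \<Rightarrow> nat \<Rightarrow> 'a set" where
  "ideal_power I 0 = UNIV"
| "ideal_power I (Suc n) = ideal_gen {x * y | x y. x \<in> I \<and> y \<in> ideal_power I n}"

definition ideal_integral_closure :: "'a::comm_ring_1 set \<Rightarrow> 'a set" where
  "ideal_integral_closure I =
     {z. \<exists>N\<ge>1. \<exists>b. (\<forall>j\<in>{1..N}. b j \<in> ideal_power I j) \<and>
           z ^ N + (\<Sum>j=1..N. b j * z ^ (N - j)) = 0}"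

text \<open>
  The ring \<open>k[[x,y]]\<close> is represented as \<open>k[[y]][[x]]\<close>, i.e. by the type \<open>'k fps fps\<close>: the
  coefficient of \<open>x\<^sup>i y\<^sup>j\<close> in \<open>f\<close> is \<open>fps_nth (fps_nth f i) j\<close>.
\<close>

definition var_x :: "'k::comm_ring_1 fps fps" where
  "var_x = fps_X"

definition var_y :: "'k::comm_ring_1 fps fps" where
  "var_y = fps_const fps_X"

text \<open>
  Unlike \<^const>\<open>subdegree\<close>, this order is infinite at \<open>0\<close>.
\<close>

definition fps_ord :: "'k::zero fps \<Rightarrow> enat" where
  "fps_ord g = (if g = 0 then \<infinity> else enat (subdegree g))"

definition pair_ord :: "'k::zero fps \<times> 'k fps \<Rightarrow> enat" where
  "pair_ord \<phi> = min (fps_ord (fst \<phi>)) (fps_ord (snd \<phi>))"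

definition arcs :: "('k::zero fps \<times> 'k fps) set" where
  "arcs = {\<phi>. \<phi> \<noteq> (0, 0) \<and> fps_nth (fst \<phi>) 0 = 0 \<and> fps_nth (snd \<phi>) 0 = 0}"

text \<open>
  Substitution \<open>f(\<phi>\<^sub>1(t), \<phi>\<^sub>2(t))\<close>, meaningful only if both components of \<open>\<phi>\<close> have zero constant
  term.  Then \<open>\<phi>\<^sub>1\<^sup>i \<phi>\<^sub>2\<^sup>j\<close> has order at least \<open>i + j\<close>, so that only the terms with
  \<open>i, j \<le> n\<close> contribute to the \<open>n\<close>-th coefficient; see \<open>fps_nth_fps_subst2\<close> below.
\<close>

definition fps_subst2 :: "'k::comm_ring_1 fps fps \<Rightarrow> 'k fps \<times> 'k fps \<Rightarrow> 'k fps" where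
  "fps_subst2 f \<phi> = Abs_fps (\<lambda>n. \<Sum>i\<le>n. \<Sum>j\<le>n.
     fps_nth (fps_nth f i) j * fps_nth (fst \<phi> ^ i * snd \<phi> ^ j) n)"

lemma fps_nth_power_mult_power_eq_0:
  fixes u v :: "'k::comm_ring_1 fps"
  assumes "fps_nth u 0 = 0" "fps_nth v 0 = 0" "n < i + j"
  shows "fps_nth (u ^ i * v ^ j) n = 0"
proof -
  have "fps_nth (u ^ i) l * fps_nth (v ^ j) (n - l) = 0" if "l \<le> n" for l
  proof (cases "l < i")
    case True
    then show ?thesis using startsby_zero_power_prefix[OF assms(1)] by simp
  next
    case False
    then have "n - l < j" using that assms(3) by linarith
    then show ?thesis using startsby_zero_power_prefix[OF assms(2)] by simp
  qed
  then show ?thesis by (simp add: fps_mult_nth)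
qed

lemma fps_nth_fps_subst2:
  fixes f :: "'k::comm_ring_1 fps fps"
  assumes "fps_nth (fst \<phi>) 0 = 0" "fps_nth (snd \<phi>) 0 = 0" "n \<le> m"
  shows "fps_nth (fps_subst2 f \<phi>) n =
    fps_nth (\<Sum>i\<le>m. \<Sum>j\<le>m. fps_const (fps_nth (fps_nth f i) j) * (fst \<phi> ^ i * snd \<phi> ^ j)) n"
proof -
  let ?c = "\<lambda>i j. fps_nth (fps_nth f i) j * fps_nth (fst \<phi> ^ i * snd \<phi> ^ j) n"
  note z = fps_nth_power_mult_power_eq_0[OF assms(1,2)]
  have "(\<Sum>i\<le>n. \<Sum>j\<le>n. ?c i j) = (\<Sum>i\<le>n. \<Sum>j\<le>m. ?c i j)"
    by (intro sum.cong refl sum.mono_neutral_left) (use assms(3) in \<open>auto simp: z\<close>)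
  also have "\<dots> = (\<Sum>i\<le>m. \<Sum>j\<le>m. ?c i j)"
    by (intro sum.mono_neutral_left) (use assms(3) in \<open>auto simp: z intro!: sum.neutral\<close>)
  finally show ?thesis
    by (simp add: fps_subst2_def fps_sum_nth)
qed

definition lojasiewicz_exponent :: "'k::comm_ring_1 fps fps set \<Rightarrow> ennreal" where
  "lojasiewicz_exponent I =
     (SUP \<phi>\<in>arcs. INF f\<in>I.
        ennreal_of_enat (fps_ord (fps_subst2 f \<phi>)) / ennreal_of_enat (pair_ord \<phi>))"

end

(*
  For \<le>: an integral equation for x^p and y^p over a^q bounds their orders along every arc from below.
  For \<ge>: if p/q exceeds the supremum, the orders along arcs do not obstruct the integrality of
  (x, y)^p over a^q, so what is needed is the valuative criterion with arcs as the only valuations,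
  for ideals I that contain a power of (x, y). It is proved by blowing up the origin. The weak
  transforms of I at the points of the exceptional line satisfy the hypothesis again. The order r of I
  does not increase, and as long as it stays equal to r > 0 an exponent K with x^K in I drops by r,
  so one reaches the unit ideal. Integrality descends: if z is integral over I at every point of the
  exceptional line, then for some n and s
      z^n (x, y)^s \<subseteq> (I z^(n-1) + I^2 z^(n-2) + ... + I^n) (x, y)^s,
  and the determinant trick applies. The criterion is used twice: first for a + (x, y)^(p+1) with an
  integer p above the supremum, which yields elements of a with initial forms x^A and y^B, so that a
  contains a power of (x, y); then for a^q.
*)
theory Submission
  imports Defs "Jordan_Normal_Form.Determinant"
begin

subsection \<open>Ideals and integral dependence\<close>

text \<open>Integrality of z over I is used in the form z^n in \<open>dep I z n\<close> with n \<ge>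
  1, a linear condition on an ideal that can be carried through ring maps, truncated and patched.
  The obstacle in the descent is that the points of the exceptional line live in complete rings
  k[[x, t - c]], while patching takes place in k[t][[x]]. If F is the initial form, taken at (1, t),
  of an element of I of order r, then x^(r n) times a power of F lies in the extension of
  \<open>dep I z n\<close>; this absorbs the error of replacing series in t - c by polynomials. The
  polynomials G with G z^n in that extension for some n form an ideal without common root, which
  contains 1. A power of (x, y) in I leaves only finitely many coefficients in x to care for, so
  some x^s clears all powers of t. The exponent of x drops because an order r that persists makes
  the new ideal regular: it contains a series whose part free of x has order r in y. At the next
  blow-up the direction x = 0 then gives the unit ideal, and in every other direction x^M becomes
  x^M times a unit. Hence an outer induction on r and an inner one on M.\<close>

lemma ideal_zeroI: "is_ideal I \<Longrightarrow> 0 \<in> I"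
  and ideal_add: "is_ideal I \<Longrightarrow> x \<in> I \<Longrightarrow> y \<in> I \<Longrightarrow> x + y \<in> I"
  and ideal_multL: "is_ideal I \<Longrightarrow> x \<in> I \<Longrightarrow> r * x \<in> I"
  by (auto simp: is_ideal_iff)

lemma ideal_multR: "is_ideal I \<Longrightarrow> x \<in> I \<Longrightarrow> x * r \<in> I"
  by (metis ideal_multL mult.commute)

lemma ideal_minus: "is_ideal I \<Longrightarrow> x \<in> I \<Longrightarrow> - x \<in> I"
  using ideal_multL[of I x "-1"] by simp

lemma ideal_diff: "is_ideal I \<Longrightarrow> x \<in> I \<Longrightarrow> y \<in> I \<Longrightarrow> x - y \<in> I"
  using ideal_add[of I x "-y"] ideal_minus[of I y] by simp

lemma ideal_sum: "is_ideal I \<Longrightarrow> (\<And>i. i \<in> S \<Longrightarrow> f i \<in> I) \<Longrightarrow> sum f S \<in> I"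
  by (induction S rule: infinite_finite_induct) (auto intro: ideal_zeroI ideal_add)

lemma ideal_UNIV_if_one: "is_ideal I \<Longrightarrow> 1 \<in> I \<Longrightarrow> I = UNIV"
  using ideal_multL[of I 1] by auto

lemma is_ideal_ideal_gen: "is_ideal (ideal_gen S)"
  by (simp add: ideal_gen_def is_ideal_def module.subspace_span[OF module_times])

lemma ideal_gen_base: "x \<in> S \<Longrightarrow> x \<in> ideal_gen S"
  by (auto simp: ideal_gen_eq_Inter)

lemma ideal_gen_least: "is_ideal I \<Longrightarrow> S \<subseteq> I \<Longrightarrow> ideal_gen S \<subseteq> I"
  by (auto simp: ideal_gen_eq_Inter)

lemma ideal_gen_induct [consumes 1, case_names zero step]:
  assumes "x \<in> ideal_gen S" "P 0" "\<And>r s x. s \<in> S \<Longrightarrow> P x \<Longrightarrow> P (r * s + x)"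
  shows "P x"
  using module.span_induct_alt[OF module_times, of x S P] assms by (auto simp: ideal_gen_def)

lemma is_ideal_power: "is_ideal (ideal_power I n)"
proof (cases n)
  case 0
  then show ?thesis by (simp add: is_ideal_iff)
qed (simp add: is_ideal_ideal_gen)

lemma ideal_power_mult:
  "x \<in> ideal_power I m \<Longrightarrow> y \<in> ideal_power I n \<Longrightarrow> x * y \<in> ideal_power I (m + n)"
proof (induction m arbitrary: x y)
  case 0
  then show ?case by (simp add: ideal_multL is_ideal_power)
next
  case (Suc m)
  from Suc.prems(1) show ?case unfolding ideal_power.simps
  proof (induction rule: ideal_gen_induct)
    case zero
    then show ?case using ideal_zeroI[OF is_ideal_power, of I "Suc m + n"] by simp
  next
    case (step r s x)
    then obtain a b where ab: "s = a * b" "a \<in> I" "b \<in> ideal_power I m" by auto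
    have "a * (b * y) \<in> ideal_power I (Suc m + n)"
      using ab Suc by (auto intro!: ideal_gen_base)
    then have "r * (a * (b * y)) + x * y \<in> ideal_power I (Suc m + n)"
      by (rule ideal_add[OF is_ideal_power ideal_multL[OF is_ideal_power] step(2)])
    then show ?case by (simp add: ab algebra_simps del: ideal_power.simps)
  qed
qed

lemma ideal_power_oneI: "x \<in> I \<Longrightarrow> x \<in> ideal_power I 1"
  using ideal_gen_base[of x "{x * y |x y. x \<in> I \<and> y \<in> UNIV}"] by (simp, metis mult_1_right)

lemma power_mem_ideal_power: "x \<in> I \<Longrightarrow> x ^ n \<in> ideal_power I n"
  by (induction n) (auto intro!: ideal_gen_base)

text \<open>The general way to bound powers from above: a chain of ideals that absorbs one factor
  from \<open>I\<close> per step dominates them, without expanding products of generators.\<close>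

lemma ideal_power_subset:
  assumes "\<And>n. is_ideal (Q n)" "1 \<in> Q 0"
    "\<And>n x y. x \<in> I \<Longrightarrow> y \<in> Q n \<Longrightarrow> x * y \<in> Q (Suc n)"
  shows "ideal_power I n \<subseteq> Q n"
proof (induction n)
  case 0
  then show ?case using ideal_UNIV_if_one[OF assms(1,2)] by simp
next
  case (Suc n)
  then have "{x * y |x y. x \<in> I \<and> y \<in> ideal_power I n} \<subseteq> Q (Suc n)" using assms(3) by blast
  then show ?case using ideal_gen_least[OF assms(1)] by simp
qed

lemma ideal_add_power_mem:
  assumes "is_ideal I" "u ^ n \<in> I" "v ^ m \<in> I"
  shows "(u + v) ^ (n + m) \<in> I"
  unfolding binomial_ring
proof (rule ideal_sum[OF assms(1)])
  fix k assume k: "k \<in> {..n + m}"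
  show "of_nat (n + m choose k) * u ^ k * v ^ (n + m - k) \<in> I"
  proof (cases "n \<le> k")
    case True
    then have "u ^ k = u ^ (k - n) * u ^ n" by (simp add: power_add[symmetric])
    then show ?thesis using assms(1,2) ideal_multL ideal_multR by metis
  next
    case False
    then have "v ^ (n + m - k) = v ^ (n - k) * v ^ m" by (simp add: power_add[symmetric])
    then show ?thesis using assms(1,3) ideal_multL by metis
  qed
qed

text \<open>The possible right-hand sides of an integral equation for \<open>z ^ n\<close> over \<open>I\<close>.\<close>

definition dep :: "'a::comm_ring_1 set \<Rightarrow> 'a \<Rightarrow> nat \<Rightarrow> 'a set" where
  "dep I z n = {\<Sum>j=1..n. b j * z ^ (n - j) | b. \<forall>j\<in>{1..n}. b j \<in> ideal_power I j}"

lemma is_ideal_dep: "is_ideal (dep I z n)"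
  unfolding is_ideal_iff
proof (intro conjI ballI allI)
  show "0 \<in> dep I z n" unfolding dep_def
    by (auto intro!: exI[of _ "\<lambda>_. 0"] simp: ideal_zeroI is_ideal_power)
next
  fix x y assume "x \<in> dep I z n" "y \<in> dep I z n"
  then obtain b c where "x = (\<Sum>j=1..n. b j * z ^ (n - j))" "y = (\<Sum>j=1..n. c j * z ^ (n - j))"
    "\<forall>j\<in>{1..n}. b j \<in> ideal_power I j" "\<forall>j\<in>{1..n}. c j \<in> ideal_power I j"
    by (auto simp: dep_def)
  then show "x + y \<in> dep I z n" unfolding dep_def
    by (auto intro!: exI[of _ "\<lambda>j. b j + c j"] simp: ideal_add is_ideal_power sum.distrib algebra_simps)
next
  fix r x assume "x \<in> dep I z n"
  then obtain b where "x = (\<Sum>j=1..n. b j * z ^ (n - j))"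
    "\<forall>j\<in>{1..n}. b j \<in> ideal_power I j"
    by (auto simp: dep_def)
  then show "r * x \<in> dep I z n" unfolding dep_def
    by (auto intro!: exI[of _ "\<lambda>j. r * b j"] simp: ideal_multL is_ideal_power sum_distrib_left algebra_simps)
qed

lemma dep_term:
  assumes "b \<in> ideal_power I j" "1 \<le> j" "j \<le> n"
  shows "b * z ^ (n - j) \<in> dep I z n"
proof -
  have "b * z ^ (n - j) = (\<Sum>i=1..n. (if i = j then b else 0) * z ^ (n - i))"
    using assms by (simp add: if_distrib[of "\<lambda>u. u * _"] sum.delta cong: if_cong)
  then show ?thesis unfolding dep_def using assms
    by (auto intro!: exI[of _ "\<lambda>i. if i = j then b else 0"] simp: ideal_zeroI is_ideal_power)
qed

lemma dep_least:
  assumes "is_ideal Q" "\<And>b j. b \<in> ideal_power I j \<Longrightarrow> 1 \<le> j \<Longrightarrow> j \<le> n \<Longrightarrow> b * z ^ (n - j) \<in> Q"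
  shows "dep I z n \<subseteq> Q"
  using assms by (auto simp: dep_def intro!: ideal_sum)

lemma integral_closure_iff_dep:
  "z \<in> ideal_integral_closure I \<longleftrightarrow> (\<exists>n\<ge>1. z ^ n \<in> dep I z n)"
proof
  assume "z \<in> ideal_integral_closure I"
  then obtain N b where N: "N \<ge> 1" "\<forall>j\<in>{1..N}. b j \<in> ideal_power I j"
    "z ^ N + (\<Sum>j=1..N. b j * z ^ (N - j)) = 0"
    by (auto simp: ideal_integral_closure_def)
  have "z ^ N = - (\<Sum>j=1..N. b j * z ^ (N - j))" using N(3) by (simp add: add_eq_0_iff)
  moreover have "(\<Sum>j=1..N. b j * z ^ (N - j)) \<in> dep I z N"
    using N(2) by (auto simp: dep_def)
  ultimately have "z ^ N \<in> dep I z N" by (simp add: ideal_minus is_ideal_dep)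
  then show "\<exists>n\<ge>1. z ^ n \<in> dep I z n" using N(1) by blast
next
  assume "\<exists>n\<ge>1. z ^ n \<in> dep I z n"
  then obtain n b where n: "n \<ge> 1" "z ^ n = (\<Sum>j=1..n. b j * z ^ (n - j))"
    "\<forall>j\<in>{1..n}. b j \<in> ideal_power I j" by (auto simp: dep_def)
  then have "z ^ n + (\<Sum>j=1..n. (- b j) * z ^ (n - j)) = 0" by (simp add: sum_negf)
  moreover have "\<forall>j\<in>{1..n}. - b j \<in> ideal_power I j"
    using n(3) by (auto intro: ideal_minus is_ideal_power)
  ultimately show "z \<in> ideal_integral_closure I" using n(1)
    unfolding ideal_integral_closure_def mem_Collect_eq by (intro exI[of _ n] exI[of _ "\<lambda>j. - b j"] conjI)
qed

lemma dep_mult_power: "x \<in> dep I z n \<Longrightarrow> x * z ^ k \<in> dep I z (n + k)"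
proof -
  assume "x \<in> dep I z n"
  then obtain b where b: "x = (\<Sum>j=1..n. b j * z ^ (n - j))"
    "\<forall>j\<in>{1..n}. b j \<in> ideal_power I j" by (auto simp: dep_def)
  have "x * z ^ k = (\<Sum>j=1..n. b j * z ^ (n + k - j))"
    unfolding b(1) sum_distrib_right
    by (intro sum.cong refl) (auto simp: mult.assoc power_add[symmetric])
  also have "\<dots> \<in> dep I z (n + k)"
    using b(2) by (auto intro!: ideal_sum is_ideal_dep dep_term)
  finally show ?thesis .
qed

lemma dep_mult_ideal_power:
  assumes "x \<in> dep I z n" "c \<in> ideal_power I k"
  shows "c * x \<in> dep I z (n + k)"
proof -
  obtain b where b: "x = (\<Sum>j=1..n. b j * z ^ (n - j))"
    "\<forall>j\<in>{1..n}. b j \<in> ideal_power I j" using assms by (auto simp: dep_def)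
  have "c * x = (\<Sum>j=1..n. c * b j * z ^ (n + k - (j + k)))"
    unfolding b(1) sum_distrib_left by (intro sum.cong refl) (auto simp: mult.assoc)
  also have "\<dots> \<in> dep I z (n + k)"
  proof (intro ideal_sum is_ideal_dep)
    fix j assume j: "j \<in> {1..n}"
    have "c * b j \<in> ideal_power I (j + k)"
      using ideal_power_mult[OF assms(2), of "b j" j] b(2) j by (simp add: add.commute)
    then show "c * b j * z ^ (n + k - (j + k)) \<in> dep I z (n + k)"
      using j by (intro dep_term) auto
  qed
  finally show ?thesis .
qed

text \<open>For n \<ge> 1 the set \<open>dep I z n\<close> is the product ideal I (I + (z))^(n-1),
  which is why degrees add up.\<close>

lemma dep_mult:
  assumes "x \<in> dep I z n" "y \<in> dep I z m"
  shows "x * y \<in> dep I z (n + m)"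
proof -
  obtain b where b: "y = (\<Sum>j=1..m. b j * z ^ (m - j))"
    "\<forall>j\<in>{1..m}. b j \<in> ideal_power I j" using assms by (auto simp: dep_def)
  have "x * y = (\<Sum>j=1..m. (b j * x) * z ^ (m - j))"
    unfolding b(1) sum_distrib_left by (intro sum.cong refl) (auto simp: algebra_simps)
  also have "\<dots> \<in> dep I z (n + m)"
  proof (intro ideal_sum is_ideal_dep)
    fix j assume j: "j \<in> {1..m}"
    have "(b j * x) * z ^ (m - j) \<in> dep I z (n + j + (m - j))"
      using b(2) j assms(1) by (intro dep_mult_power dep_mult_ideal_power) auto
    then show "(b j * x) * z ^ (m - j) \<in> dep I z (n + m)" using j by simp
  qed
  finally show ?thesis .
qed

lemma ideal_power_subset_dep: "1 \<le> n \<Longrightarrow> ideal_power I n \<subseteq> dep I z n"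
  using dep_term[of _ I n n z] by auto

text \<open>Prepares the Leibniz expansion of a determinant: modulo \<open>dep\<close>, each entry
  may be replaced by its leading part e i z^n, where e i will be an entry of the identity matrix.
  The error stays homogeneous in the degree.\<close>

lemma prod_cong_mod_dep:
  assumes "finite S" "\<And>i. i \<in> S \<Longrightarrow> a i - e i * z ^ n \<in> dep I z n"
  shows "prod a S - prod e S * z ^ (n * card S) \<in> dep I z (n * card S)"
  using assms
proof (induction S)
  case empty
  then show ?case by (simp add: ideal_zeroI is_ideal_dep)
next
  case (insert i S)
  let ?d = "a i - e i * z ^ n" and ?D = "prod a S - prod e S * z ^ (n * card S)"
  have d: "?d \<in> dep I z n" and D: "?D \<in> dep I z (n * card S)" using insert by auto
  have eq: "prod a (insert i S) - prod e (insert i S) * z ^ (n * card (insert i S)) =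
     ?d * ?D + e i * (?D * z ^ n) + prod e S * (?d * z ^ (n * card S))"
    using insert by (simp add: algebra_simps power_add)
  have s: "n * card (insert i S) = n * card S + n" using insert by simp
  show ?case unfolding eq unfolding s
    using dep_mult[OF d D] dep_mult_power[OF D, of n] dep_mult_power[OF d, of "n * card S"]
    by (auto intro!: ideal_add ideal_multL is_ideal_dep simp: add.commute)
qed

text \<open>The determinant trick in homogeneous form. The nonzero vector v is annihilated by z^n Id
  - b, so the determinant vanishes. Among its Leibniz terms only the identity permutation has a
  leading part, namely z^(n N); everything else lies in \<open>dep I z (n * N)\<close>.\<close>

lemma integral_closure_if_stable:
  fixes z :: "'a::idom" and N :: nat
  assumes eq: "\<And>i. i < N \<Longrightarrow> z ^ n * v i = (\<Sum>j<N. b i j * v j)"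
    and b: "\<And>i j. i < N \<Longrightarrow> j < N \<Longrightarrow> b i j \<in> dep I z n"
    and nz: "k < N" "v k \<noteq> 0" and n: "1 \<le> n"
  shows "z \<in> ideal_integral_closure I"
proof -
  define A where "A = mat N N (\<lambda>(i, j). (if i = j then z ^ n else 0) - b i j)"
  have A: "A \<in> carrier_mat N N" by (simp add: A_def)
  have "A *\<^sub>v vec N v = 0\<^sub>v N"
  proof (rule eq_vecI)
    fix i assume i: "i < dim_vec (0\<^sub>v N :: 'a vec)"
    have "(A *\<^sub>v vec N v) $ i = (\<Sum>j<N. ((if i = j then z ^ n else 0) - b i j) * v j)"
      using i by (simp add: A_def scalar_prod_def lessThan_atLeast0)
    also have "\<dots> = z ^ n * v i - (\<Sum>j<N. b i j * v j)"
      using i by (simp add: left_diff_distrib sum_subtractf if_distrib[of "\<lambda>u. u * _"] cong: if_cong)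
    finally show "(A *\<^sub>v vec N v) $ i = 0\<^sub>v N $ i" using i eq by simp
  qed (simp add: A_def)
  moreover have "vec N v \<noteq> 0\<^sub>v N"
    using nz by (metis index_vec index_zero_vec(1))
  ultimately have "det A = 0" using det_0_iff_vec_prod_zero[OF A] by (meson vec_carrier)
  then have det: "(\<Sum>p | p permutes {0..<N}. signof p * (\<Prod>i = 0..<N. A $$ (i, p i))) = 0"
    using det_def'[OF A] by simp
  let ?P = "\<lambda>p. \<Prod>i = 0..<N. A $$ (i, p i)"
  have P: "?P p - (\<Prod>i = 0..<N. if p i = i then 1 else 0) * z ^ (n * N) \<in> dep I z (n * N)"
    if p: "p permutes {0..<N}" for p
  proof -
    have "?P p - (\<Prod>i = 0..<N. if p i = i then 1 else 0) * z ^ (n * card {0..<N})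
        \<in> dep I z (n * card {0..<N})"
    proof (rule prod_cong_mod_dep)
      fix i assume i: "i \<in> {0..<N}"
      then have pi: "p i < N" using p by (metis permutes_in_image atLeastLessThan_iff)
      have "A $$ (i, p i) - (if p i = i then 1 else 0) * z ^ n = - b i (p i)"
        using i pi by (simp add: A_def)
      then show "A $$ (i, p i) - (if p i = i then 1 else 0) * z ^ n \<in> dep I z n"
        using b i pi by (auto intro!: ideal_minus is_ideal_dep)
    qed simp
    then show ?thesis by simp
  qed
  have nonid: "?P p \<in> dep I z (n * N)" if p: "p permutes {0..<N}" "p \<noteq> id" for p
  proof -
    obtain i where "p i \<noteq> i" using p(2) by (auto simp: fun_eq_iff)
    then have "i \<in> {0..<N}" using p(1) by (meson permutes_not_in)
    then have "(\<Prod>i = 0..<N. if p i = i then 1 else (0::'a)) = 0"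
      using \<open>p i \<noteq> i\<close> by (intro prod_zero) auto
    then show ?thesis using P[OF p(1)] by (simp only: mult_zero_left diff_0_right)
  qed
  have fin: "finite {p. p permutes {0..<N}}" by (simp add: finite_permutations)
  have id: "id \<in> {p. p permutes {0..<N}}" by (simp add: permutes_id)
  have "(\<Sum>p \<in> {p. p permutes {0..<N}} - {id}. signof p * ?P p) \<in> dep I z (n * N)"
    using nonid by (auto intro!: ideal_sum ideal_multL is_ideal_dep)
  moreover have "signof id * ?P id = - (\<Sum>p \<in> {p. p permutes {0..<N}} - {id}. signof p * ?P p)"
    using det sum.remove[OF fin id, of "\<lambda>p. signof p * ?P p"] by (simp add: add_eq_0_iff)
  ultimately have "?P id \<in> dep I z (n * N)"
    by (simp add: ideal_minus is_ideal_dep)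
  moreover have "?P id - z ^ (n * N) \<in> dep I z (n * N)"
    using P[of id] by (simp add: permutes_id)
  ultimately have "?P id - (?P id - z ^ (n * N)) \<in> dep I z (n * N)"
    by (rule ideal_diff[OF is_ideal_dep])
  then have "z ^ (n * N) \<in> dep I z (n * N)" by (simp only: diff_diff_eq2 add_diff_cancel_left')
  moreover have "1 \<le> n * N" using n nz by simp
  ultimately show ?thesis unfolding integral_closure_iff_dep by blast
qed

lemma ideal_power_scaled:
  assumes "\<And>h. h \<in> I' \<Longrightarrow> u * h \<in> I" "x \<in> ideal_power I' j"
  shows "u ^ j * x \<in> ideal_power I j"
proof -
  have "ideal_power I' j \<subseteq> {x. u ^ j * x \<in> ideal_power I j}"
  proof (rule ideal_power_subset[where Q = "\<lambda>j. {x. u ^ j * x \<in> ideal_power I j}"])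
    show "is_ideal {x. u ^ j * x \<in> ideal_power I j}" for j
      unfolding is_ideal_iff using is_ideal_power[of I j]
      by (auto simp: ideal_zeroI ideal_add distrib_left mult.left_commute[of "u ^ j"] ideal_multL)
    fix n x y assume "x \<in> I'" "y \<in> {x. u ^ n * x \<in> ideal_power I n}"
    then have "(u * x) * (u ^ n * y) \<in> ideal_power I (1 + n)"
      using assms(1) by (intro ideal_power_mult ideal_power_oneI) auto
    then show "x * y \<in> {x. u ^ Suc n * x \<in> ideal_power I (Suc n)}"
      by (simp add: algebra_simps)
  qed simp
  then show ?thesis using assms(2) by auto
qed

text \<open>Multiplying an integral equation of degree n for z by u^n turns b_j into u^j b_j. Serves
  to return from a weak transform to the extended ideal, with u the r-th power of the exceptional
  coordinate.\<close>

lemma integral_closure_scaled: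
  assumes "\<And>h. h \<in> I' \<Longrightarrow> u * h \<in> I" "z \<in> ideal_integral_closure I'"
  shows "u * z \<in> ideal_integral_closure I"
proof -
  obtain n where n: "n \<ge> 1" "z ^ n \<in> dep I' z n"
    using assms(2) by (auto simp: integral_closure_iff_dep)
  have "dep I' z n \<subseteq> {x. u ^ n * x \<in> dep I (u * z) n}"
  proof (rule dep_least)
    show "is_ideal {x. u ^ n * x \<in> dep I (u * z) n}"
      unfolding is_ideal_iff using is_ideal_dep[of I "u * z" n]
      by (auto simp: ideal_zeroI ideal_add distrib_left mult.left_commute[of "u ^ n"] ideal_multL)
    fix b j assume j: "b \<in> ideal_power I' j" "1 \<le> j" "j \<le> n"
    have "(u ^ j * b) * (u * z) ^ (n - j) \<in> dep I (u * z) n"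
      using j assms(1) by (intro dep_term ideal_power_scaled[of I']) auto
    moreover have "u ^ n = u ^ j * u ^ (n - j)" using j by (simp add: power_add[symmetric])
    ultimately show "b * z ^ (n - j) \<in> {x. u ^ n * x \<in> dep I (u * z) n}"
      by (simp add: power_mult_distrib algebra_simps)
  qed
  then show ?thesis using n by (auto simp: integral_closure_iff_dep power_mult_distrib)
qed

section \<open>Integral dependence and ring homomorphisms\<close>

context comm_ring_hom
begin

lemma is_ideal_vimage: "is_ideal J \<Longrightarrow> is_ideal {x. hom x \<in> J}"
  unfolding is_ideal_iff by (auto simp: hom_zero hom_add hom_mult)

lemma ideal_power_hom:
  "ideal_power (ideal_gen (hom ` I)) n \<subseteq> ideal_gen (hom ` ideal_power I n)"
proof (rule ideal_power_subset)
  show "1 \<in> ideal_gen (hom ` ideal_power I 0)"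
    by (rule ideal_gen_base) (auto simp: image_iff hom_one intro!: exI[of _ 1])
  fix n x y assume x: "x \<in> ideal_gen (hom ` I)" and y: "y \<in> ideal_gen (hom ` ideal_power I n)"
  let ?Q = "ideal_gen (hom ` ideal_power I (Suc n))"
  have Q: "is_ideal ?Q" by (rule is_ideal_ideal_gen)
  have 1: "hom a * y \<in> ?Q" if "a \<in> I" for a
    using y
  proof (induction rule: ideal_gen_induct)
    case (step r s x)
    then obtain b where b: "s = hom b" "b \<in> ideal_power I n" by auto
    have "hom (a * b) \<in> ?Q" using ideal_power_mult[OF ideal_power_oneI[OF that] b(2)]
      by (intro ideal_gen_base imageI) simp
    then show ?case using step Q
      by (simp add: distrib_left b hom_mult mult.left_commute[of _ r] ideal_add ideal_multL del: ideal_power.simps)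
  qed (use ideal_zeroI[OF Q] in \<open>simp del: ideal_power.simps\<close>)
  from x show "x * y \<in> ?Q"
  proof (induction rule: ideal_gen_induct)
    case (step r s x)
    then show ?case using 1 Q by (auto simp: distrib_right mult.assoc ideal_add ideal_multL simp del: ideal_power.simps)
  qed (use ideal_zeroI[OF Q] in \<open>simp del: ideal_power.simps\<close>)
qed (auto simp: is_ideal_ideal_gen)

text \<open>Turns an integral equation in a chart into membership in the extension of an ideal of
  the base ring, the form in which it can be descended.\<close>

lemma dep_hom: "dep (ideal_gen (hom ` I)) (hom z) n \<subseteq> ideal_gen (hom ` dep I z n)"
proof (rule dep_least)
  let ?Q = "ideal_gen (hom ` dep I z n)"
  show Q: "is_ideal ?Q" by (rule is_ideal_ideal_gen)
  fix b j assume j: "b \<in> ideal_power (ideal_gen (hom ` I)) j" "1 \<le> j" "j \<le> n"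
  have "b \<in> ideal_gen (hom ` ideal_power I j)" using ideal_power_hom j(1) by blast
  then show "b * hom z ^ (n - j) \<in> ?Q"
  proof (induction rule: ideal_gen_induct)
    case (step r s x)
    then obtain c where c: "s = hom c" "c \<in> ideal_power I j" by auto
    have "hom (c * z ^ (n - j)) \<in> ?Q" using dep_term[OF c(2) j(2,3)]
      by (intro ideal_gen_base imageI)
    then show ?case using step Q
      by (auto simp: distrib_right c hom_mult hom_power mult.assoc ideal_add ideal_multL)
  qed (simp add: ideal_zeroI[OF Q])
qed

end

no_notation vec_index (infixl "$" 100)
unbundle fps_syntax

subsection \<open>Power series in two variables\<close>

text \<open>The power \<open>(x, y)\<^sup>s\<close>, described by coefficients.\<close>

definition mpow :: "nat \<Rightarrow> 'a::comm_ring_1 fps fps set" where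
  "mpow s = {f. \<forall>i j. i + j < s \<longrightarrow> fps_nth (fps_nth f i) j = 0}"

lemma mpowD: "f \<in> mpow s \<Longrightarrow> i + j < s \<Longrightarrow> f $ i $ j = 0"
  by (simp add: mpow_def)

lemma mpow_0: "mpow 0 = UNIV"
  by (auto simp: mpow_def)

lemma mpow_antimono: "m \<le> n \<Longrightarrow> mpow n \<subseteq> mpow m"
  by (auto simp: mpow_def)

lemma mult_mem_mpow:
  assumes "f \<in> mpow m" "g \<in> mpow n"
  shows "f * g \<in> mpow (m + n)"
proof -
  have "f $ k $ l * g $ (i - k) $ (j - l) = 0" if "i + j < m + n" "k \<le> i" "l \<le> j" for i j k l
  proof (cases "k + l < m")
    case False
    then have "(i - k) + (j - l) < n" using that by linarith
    then show ?thesis using assms by (simp add: mpow_def)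
  qed (use assms in \<open>simp add: mpow_def\<close>)
  then show ?thesis
    by (auto simp: mpow_def fps_mult_nth fps_sum_nth intro!: sum.neutral)
qed

lemma is_ideal_mpow: "is_ideal (mpow n)"
  using mult_mem_mpow[of _ 0 _ n] by (auto simp: is_ideal_iff mpow_0) (auto simp: mpow_def)

lemma power_mem_mpow: "f \<in> mpow m \<Longrightarrow> f ^ k \<in> mpow (m * k)"
  by (induction k) (auto simp: mpow_0 intro!: mult_mem_mpow)

lemma ideal_power_subset_mpow: "I \<subseteq> mpow r \<Longrightarrow> ideal_power I n \<subseteq> mpow (r * n)"
  by (rule ideal_power_subset[where Q = "\<lambda>n. mpow (r * n)"])
    (use mult_mem_mpow[of _ r] in \<open>auto simp: is_ideal_mpow mpow_0\<close>)

lemma dep_subset_mpow: "I \<subseteq> mpow r \<Longrightarrow> z \<in> mpow r \<Longrightarrow> dep I z n \<subseteq> mpow (r * n)"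
proof (rule dep_least)
  fix b j assume *: "I \<subseteq> mpow r" "z \<in> mpow r" "b \<in> ideal_power I j" "1 \<le> j" "j \<le> n"
  have "b * z ^ (n - j) \<in> mpow (r * j + r * (n - j))"
    using * ideal_power_subset_mpow by (intro mult_mem_mpow power_mem_mpow) blast+
  then show "b * z ^ (n - j) \<in> mpow (r * n)"
    using * by (simp add: distrib_left[symmetric])
qed (rule is_ideal_mpow)

lemma var_x_mult_nth: "(var_x * f) $ i = (if i = 0 then 0 else f $ (i - 1))"
  by (simp add: var_x_def)

lemma var_y_mult_nth_nth: "(var_y * f) $ i $ j = (if j = 0 then 0 else f $ i $ (j - 1))"
  by (simp add: var_y_def)

lemma vars_mem_mpow: "var_x \<in> mpow 1" "var_y \<in> mpow 1"
  by (auto simp: mpow_def var_x_def var_y_def)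

section \<open>Maps out of k[[x,y]]\<close>

definition fps_cc :: "'a::zero \<Rightarrow> 'a fps fps" where
  "fps_cc a = fps_const (fps_const a)"

lemma fps_cc_mult_nth: "(fps_cc a * f) $ i $ j = a * f $ i $ j" for a :: "'a::comm_ring_1"
  by (simp add: fps_cc_def)

lemma fps2_split:
  fixes f :: "'a::comm_ring_1 fps fps"
  obtains f1 f2 where "f = fps_cc (f $ 0 $ 0) + var_x * f1 + var_y * f2"
    "\<And>m. f \<in> mpow (Suc m) \<Longrightarrow> f1 \<in> mpow m" "\<And>m. f \<in> mpow (Suc m) \<Longrightarrow> f2 \<in> mpow m"
proof
  let ?f1 = "Abs_fps (\<lambda>i. f $ Suc i)" and ?f2 = "fps_const (Abs_fps (\<lambda>j. f $ 0 $ Suc j))"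
  show "f = fps_cc (f $ 0 $ 0) + var_x * ?f1 + var_y * ?f2"
    by (rule fps_ext, rule fps_ext)
      (auto simp: var_x_mult_nth var_y_mult_nth_nth fps_cc_def split: nat.split
        simp del: fps_mult_right_const_nth)
qed (auto simp: mpow_def)

text \<open>Writing f as a constant plus x f1 + y f2 shows that the difference of the two maps
  vanishes to one order more at f than it does at f1 and f2, as X and Y have no constant term.
  Identities between substitutions thus need checking on constants and variables only.\<close>

lemma fps2_hom_unique:
  fixes h1 h2 :: "'a::comm_ring_1 fps fps \<Rightarrow> 'b::comm_ring_1 fps"
  assumes add: "\<And>f g. h1 (f + g) = h1 f + h1 g" "\<And>f g. h2 (f + g) = h2 f + h2 g"
    and const: "\<And>a f. h1 (fps_cc a * f) = \<iota> a * h1 f" "\<And>a f. h2 (fps_cc a * f) = \<iota> a * h2 f"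
    and x: "\<And>f. h1 (var_x * f) = X * h1 f" "\<And>f. h2 (var_x * f) = X * h2 f"
    and y: "\<And>f. h1 (var_y * f) = Y * h1 f" "\<And>f. h2 (var_y * f) = Y * h2 f"
    and XY: "X $ 0 = 0" "Y $ 0 = 0" and one: "h1 1 = h2 1"
  shows "h1 f = h2 f"
proof -
  have "\<forall>f. \<forall>k<n. (h1 f - h2 f) $ k = 0" for n
  proof (induction n)
    case (Suc n)
    show ?case
    proof (intro allI impI)
      fix f :: "'a fps fps" and k assume k: "k < Suc n"
      obtain f1 f2 where f: "f = fps_cc (f $ 0 $ 0) * 1 + var_x * f1 + var_y * f2"
        by (rule fps2_split[of f]) simp
      have eq: "h1 f - h2 f = X * (h1 f1 - h2 f1) + Y * (h1 f2 - h2 f2)"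
        by (subst f, subst (2) f) (simp only: add const x y one, simp add: algebra_simps)
      have "(Z * (h1 g - h2 g)) $ k = 0" if "Z $ 0 = 0" for Z :: "'b fps" and g
        unfolding fps_mult_nth
      proof (rule sum.neutral, rule ballI)
        fix i assume "i \<in> {0..k}"
        then have "i = 0 \<or> k - i < n" using k by auto
        then show "Z $ i * (h1 g - h2 g) $ (k - i) = 0" using that Suc by (auto simp del: fps_sub_nth)
      qed
      then show "(h1 f - h2 f) $ k = 0" unfolding eq using XY by simp
    qed
  qed simp
  then have "h1 f - h2 f = 0" by (intro fps_ext) (metis fps_zero_nth lessI)
  then show ?thesis by simp
qed

text \<open>For fixed g both sides are additive in f and behave alike under constants, x and y, so
  uniqueness replaces a convolution of double sums.\<close>

lemma fps2_hom_mult: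
  fixes h :: "'a::comm_ring_1 fps fps \<Rightarrow> 'b::comm_ring_1 fps"
  assumes add: "\<And>f g. h (f + g) = h f + h g"
    and const: "\<And>a f. h (fps_cc a * f) = \<iota> a * h f"
    and x: "\<And>f. h (var_x * f) = X * h f" and y: "\<And>f. h (var_y * f) = Y * h f"
    and XY: "X $ 0 = 0" "Y $ 0 = 0" and one: "h 1 = 1"
  shows "h (f * g) = h f * h g"
  by (rule fps2_hom_unique[where ?h1.0 = "\<lambda>f. h (f * g)" and ?h2.0 = "\<lambda>f. h f * h g"
        and \<iota> = \<iota> and X = X and Y = Y])
    (simp_all only: distrib_right mult.assoc mult_1_left add const x y XY one)

text \<open>For an ideal \<open>J\<close> this is the product ideal \<open>J (x, y)\<^sup>s\<close>.\<close>

definition forms :: "'a::comm_ring_1 fps fps set \<Rightarrow> nat \<Rightarrow> 'a fps fps set" where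
  "forms J s = {\<Sum>i\<le>s. g i * (var_x ^ i * var_y ^ (s - i)) | g. \<forall>i\<le>s. g i \<in> J}"

lemma is_ideal_forms:
  assumes "is_ideal J"
  shows "is_ideal (forms J s)"
  unfolding is_ideal_iff
proof (intro conjI ballI allI)
  show "0 \<in> forms J s" unfolding forms_def using ideal_zeroI[OF assms]
    by (auto intro!: exI[of _ "\<lambda>_. 0"])
next
  fix a b assume "a \<in> forms J s" "b \<in> forms J s"
  then obtain g h where "a = (\<Sum>i\<le>s. g i * (var_x ^ i * var_y ^ (s - i)))" "\<forall>i\<le>s. g i \<in> J"
    "b = (\<Sum>i\<le>s. h i * (var_x ^ i * var_y ^ (s - i)))" "\<forall>i\<le>s. h i \<in> J" by (auto simp: forms_def)
  then show "a + b \<in> forms J s" unfolding forms_def using ideal_add[OF assms]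
    by (auto intro!: exI[of _ "\<lambda>i. g i + h i"] simp: distrib_right sum.distrib)
next
  fix r a assume "a \<in> forms J s"
  then obtain g where "a = (\<Sum>i\<le>s. g i * (var_x ^ i * var_y ^ (s - i)))" "\<forall>i\<le>s. g i \<in> J"
    by (auto simp: forms_def)
  then show "r * a \<in> forms J s" unfolding forms_def using ideal_multL[OF assms]
    by (auto intro!: exI[of _ "\<lambda>i. r * g i"] simp: mult.assoc sum_distrib_left)
qed

lemma forms_mult_var_x:
  assumes "is_ideal J" "a \<in> forms J s"
  shows "var_x * a \<in> forms J (Suc s)"
proof -
  obtain g where g: "a = (\<Sum>i\<le>s. g i * (var_x ^ i * var_y ^ (s - i)))" "\<forall>i\<le>s. g i \<in> J"
    using assms by (auto simp: forms_def)
  let ?g = "\<lambda>i. if i = 0 then 0 else g (i - 1)"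
  have "var_x * a = (\<Sum>i\<le>Suc s. ?g i * (var_x ^ i * var_y ^ (Suc s - i)))"
    unfolding g(1) sum.atMost_Suc_shift by (simp add: sum_distrib_left algebra_simps)
  then show ?thesis unfolding forms_def using g(2) ideal_zeroI[OF assms(1)]
    by (auto intro!: exI[of _ ?g])
qed

lemma forms_mult_var_y:
  assumes "is_ideal J" "a \<in> forms J s"
  shows "var_y * a \<in> forms J (Suc s)"
proof -
  obtain g where g: "a = (\<Sum>i\<le>s. g i * (var_x ^ i * var_y ^ (s - i)))" "\<forall>i\<le>s. g i \<in> J"
    using assms by (auto simp: forms_def)
  let ?g = "\<lambda>i. if i = Suc s then 0 else g i"
  have "var_y * a = (\<Sum>i\<le>Suc s. ?g i * (var_x ^ i * var_y ^ (Suc s - i)))"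
    unfolding g(1) sum.atMost_Suc by (simp add: sum_distrib_left algebra_simps Suc_diff_le)
  then show ?thesis unfolding forms_def using g(2) ideal_zeroI[OF assms(1)]
    by (auto intro!: exI[of _ ?g])
qed

lemma forms_mult_monom:
  assumes "is_ideal J" "a \<in> forms J s"
  shows "var_x ^ i * var_y ^ j * a \<in> forms J (i + j + s)"
proof (induction i)
  case 0
  show ?case
  proof (induction j)
    case (Suc j)
    then show ?case using forms_mult_var_y[OF assms(1) Suc] by (simp add: mult.assoc)
  qed (use assms in simp)
next
  case (Suc i)
  then show ?case using forms_mult_var_x[OF assms(1) Suc] by (simp add: mult.assoc)
qed

lemma forms_mono: "J \<subseteq> J' \<Longrightarrow> forms J s \<subseteq> forms J' s"
  by (auto simp: forms_def subset_iff)

lemma mpow_subset_forms: "mpow (s + m) \<subseteq> forms (mpow m) s"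
proof (induction s)
  case 0
  show ?case by (auto simp: forms_def)
next
  case (Suc s)
  show ?case
  proof
    fix f :: "'a fps fps" assume f: "f \<in> mpow (Suc s + m)"
    obtain f1 f2 where *: "f = fps_cc (f $ 0 $ 0) + var_x * f1 + var_y * f2"
      "f1 \<in> mpow (s + m)" "f2 \<in> mpow (s + m)"
      by (rule fps2_split[of f]) (use f in simp)
    have "f $ 0 $ 0 = 0" using f by (simp add: mpow_def)
    then have "f = var_x * f1 + var_y * f2" using *(1) by (simp add: fps_cc_def)
    moreover have "var_x * f1 \<in> forms (mpow m) (Suc s)"
      using forms_mult_var_x[OF is_ideal_mpow] *(2) Suc by blast
    moreover have "var_y * f2 \<in> forms (mpow m) (Suc s)"
      using forms_mult_var_y[OF is_ideal_mpow] *(3) Suc by blast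
    ultimately show "f \<in> forms (mpow m) (Suc s)"
      using ideal_add[OF is_ideal_forms[OF is_ideal_mpow]] by metis
  qed
qed

lemma monom_mem_mpow: "var_x ^ i * var_y ^ j \<in> mpow (i + j)"
  using mult_mem_mpow[OF power_mem_mpow power_mem_mpow] vars_mem_mpow by fastforce

lemma mult_mem_forms:
  assumes "is_ideal J" "a \<in> J" "f \<in> mpow s"
  shows "f * a \<in> forms J s"
proof -
  obtain g where g: "f = (\<Sum>i\<le>s. g i * (var_x ^ i * var_y ^ (s - i)))"
    using mpow_subset_forms[of s 0] assms(3) by (auto simp: forms_def mpow_0)
  have "f * a = (\<Sum>i\<le>s. (g i * a) * (var_x ^ i * var_y ^ (s - i)))"
    unfolding g sum_distrib_right by (simp add: algebra_simps)
  then show ?thesis unfolding forms_def using ideal_multL[OF assms(1,2)]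
    by (auto intro!: exI[of _ "\<lambda>i. g i * a"])
qed

lemma mpow_subset_ideal_power:
  assumes "is_ideal I" "mpow K \<subseteq> I"
  shows "mpow (K * n) \<subseteq> ideal_power I n"
proof (induction n)
  case (Suc n)
  show ?case
  proof
    fix f :: "'a fps fps" assume "f \<in> mpow (K * Suc n)"
    then obtain g where g: "f = (\<Sum>i\<le>K. g i * (var_x ^ i * var_y ^ (K - i)))"
      "\<forall>i\<le>K. g i \<in> mpow (K * n)"
      using mpow_subset_forms[of K "K * n"] by (auto simp: forms_def)
    have "g i * (var_x ^ i * var_y ^ (K - i)) \<in> ideal_power I (n + 1)" if "i \<le> K" for i
    proof (rule ideal_power_mult)
      show "g i \<in> ideal_power I n" using g(2) that Suc by auto
      show "var_x ^ i * var_y ^ (K - i) \<in> ideal_power I 1"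
        using monom_mem_mpow[of i "K - i"] that assms(2) by (intro ideal_power_oneI) auto
    qed
    then show "f \<in> ideal_power I (Suc n)" unfolding g(1)
      by (intro ideal_sum is_ideal_power) simp
  qed
qed (simp add: mpow_0)

lemma mpow_subset_if_pure_powers:
  assumes "is_ideal I" "var_x ^ a \<in> I" "var_y ^ b \<in> I"
  shows "mpow (a + b) \<subseteq> I"
proof
  fix f :: "'a fps fps" assume "f \<in> mpow (a + b)"
  then obtain g where g: "f = (\<Sum>i\<le>a+b. g i * (var_x ^ i * var_y ^ (a + b - i)))"
    using mpow_subset_forms[of "a + b" 0] by (auto simp: forms_def)
  have "var_x ^ i * var_y ^ (a + b - i) \<in> I" for i
  proof (cases "a \<le> i")
    case True
    then have "var_x ^ i = var_x ^ (i - a) * (var_x ^ a :: 'a fps fps)" by (simp flip: power_add)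
    then show ?thesis using ideal_multR[OF assms(1) ideal_multL[OF assms(1,2)]] by simp
  next
    case False
    then have "var_y ^ (a + b - i) = var_y ^ (a - i) * (var_y ^ b :: 'a fps fps)"
      by (simp flip: power_add)
    then show ?thesis using ideal_multL[OF assms(1) ideal_multL[OF assms(1,3)]] by simp
  qed
  then have "g i * (var_x ^ i * var_y ^ (a + b - i)) \<in> I" for i by (rule ideal_multL[OF assms(1)])
  then show "f \<in> I" unfolding g by (rule ideal_sum[OF assms(1)])
qed

text \<open>Exchanges the two charts of the blow-up, so that only the chart (x, x t) has to be
  constructed; the point missing there is reached through the swapped ideal.\<close>

definition swap_vars :: "'a fps fps \<Rightarrow> 'a fps fps" where
  "swap_vars f = Abs_fps (\<lambda>i. Abs_fps (\<lambda>j. f $ j $ i))"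

lemma swap_vars_nth [simp]: "swap_vars f $ i $ j = f $ j $ i"
  by (simp add: swap_vars_def)

lemma swap_swap [simp]: "swap_vars (swap_vars f) = f"
  by (intro fps_ext) simp

interpretation swap: comm_ring_hom "swap_vars :: 'a::comm_ring_1 fps fps \<Rightarrow> _"
proof
  fix f g :: "'a fps fps"
  show "swap_vars (0::'a fps fps) = 0" by (intro fps_ext) simp
  show "swap_vars (f + g) = swap_vars f + swap_vars g" by (intro fps_ext) simp
  show "swap_vars (1::'a fps fps) = 1" by (intro fps_ext) (simp add: fps_one_nth)
  show "swap_vars (f * g) = swap_vars f * swap_vars g"
    by (intro fps_ext) (simp add: fps_mult_nth fps_sum_nth, rule sum.swap)
qed

lemma swap_var_x: "swap_vars var_x = var_y" and swap_var_y: "swap_vars var_y = var_x"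
  by (intro fps_ext; simp add: var_x_def var_y_def fps_X_def)+

lemma swap_image_eq: "swap_vars ` I = {f. swap_vars f \<in> I}"
  by (auto simp: image_iff) (metis swap_swap)

lemma is_ideal_swap: "is_ideal I \<Longrightarrow> is_ideal (swap_vars ` I)"
  unfolding swap_image_eq by (rule swap.is_ideal_vimage)

lemma swap_mem_mpow: "swap_vars f \<in> mpow n \<longleftrightarrow> f \<in> mpow n"
  by (auto simp: mpow_def add.commute)

lemma dep_swap_subset:
  "dep (swap_vars ` I) (swap_vars z) n \<subseteq> swap_vars ` dep I z n"
proof -
  have pow: "ideal_power (swap_vars ` I) j \<subseteq> swap_vars ` ideal_power I j" for j
  proof (rule ideal_power_subset[where Q = "\<lambda>n. swap_vars ` ideal_power I n"])
    show "is_ideal (swap_vars ` ideal_power I n)" for n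
      by (rule is_ideal_swap[OF is_ideal_power])
    show "1 \<in> swap_vars ` ideal_power I 0" by (simp add: swap_image_eq)
    fix n x y assume "x \<in> swap_vars ` I" "y \<in> swap_vars ` ideal_power I n"
    then obtain a b where "x = swap_vars a" "y = swap_vars b" "a \<in> I" "b \<in> ideal_power I n" by blast
    then show "x * y \<in> swap_vars ` ideal_power I (Suc n)"
      using ideal_power_mult[OF ideal_power_oneI, of a I b n]
      by (intro image_eqI[of _ _ "a * b"]) (simp_all only: swap.hom_mult plus_1_eq_Suc)
  qed
  show ?thesis
  proof (rule dep_least)
    fix b j assume j: "b \<in> ideal_power (swap_vars ` I) j" "1 \<le> j" "j \<le> n"
    then obtain c where c: "b = swap_vars c" "c \<in> ideal_power I j" using pow by blast
    have "b * swap_vars z ^ (n - j) = swap_vars (c * z ^ (n - j))"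
      by (simp add: c swap.hom_mult swap.hom_power)
    then show "b * swap_vars z ^ (n - j) \<in> swap_vars ` dep I z n"
      using dep_term[OF c(2) j(2,3)] by auto
  qed (simp add: is_ideal_swap is_ideal_dep)
qed

lemma forms_swap_subset:
  assumes "is_ideal J" shows "forms (swap_vars ` J) s \<subseteq> swap_vars ` forms J s"
proof
  fix a assume "a \<in> forms (swap_vars ` J) s"
  then obtain g where g: "a = (\<Sum>i\<le>s. g i * (var_x ^ i * var_y ^ (s - i)))" "\<forall>i\<le>s. swap_vars (g i) \<in> J"
    unfolding forms_def swap_image_eq by blast
  have "swap_vars a = (\<Sum>i\<le>s. (var_x ^ (s - i) * var_y ^ i) * swap_vars (g i))"
    unfolding g(1) swap.hom_sum swap.hom_mult swap.hom_power swap_var_x swap_var_y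
    by (intro sum.cong refl) (simp only: mult.commute)
  also have "\<dots> \<in> forms J s"
  proof (intro ideal_sum is_ideal_forms assms mult_mem_forms)
    fix i assume "i \<in> {..s}"
    then show "swap_vars (g i) \<in> J" "var_x ^ (s - i) * var_y ^ i \<in> mpow s"
      using g(2) monom_mem_mpow[of "s - i" i] by simp_all
  qed
  finally show "a \<in> swap_vars ` forms J s" unfolding swap_image_eq by blast
qed

subsection \<open>Arcs and the blow-up\<close>

text \<open>The two summation bounds are independent because multiplication by x or y shifts a
  single index, which destroys a square range.\<close>

lemma fps_subst2_nth:
  assumes "fst \<phi> $ 0 = 0" "snd \<phi> $ 0 = 0" "n \<le> A" "n \<le> B"
  shows "fps_subst2 f \<phi> $ n = (\<Sum>i\<le>A. \<Sum>j\<le>B. f $ i $ j * (fst \<phi> ^ i * snd \<phi> ^ j) $ n)"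
proof -
  let ?c = "\<lambda>i j. f $ i $ j * (fst \<phi> ^ i * snd \<phi> ^ j) $ n"
  note z = fps_nth_power_mult_power_eq_0[OF assms(1,2)]
  have "(\<Sum>i\<le>n. \<Sum>j\<le>n. ?c i j) = (\<Sum>i\<le>n. \<Sum>j\<le>B. ?c i j)"
    by (intro sum.cong refl sum.mono_neutral_left) (use assms(4) in \<open>auto simp: z\<close>)
  also have "\<dots> = (\<Sum>i\<le>A. \<Sum>j\<le>B. ?c i j)"
    by (intro sum.mono_neutral_left) (use assms(3) in \<open>auto simp: z intro!: sum.neutral\<close>)
  finally show ?thesis by (simp add: fps_subst2_def)
qed

lemma fps_subst2_mult_nth:
  assumes "fst \<phi> $ 0 = 0" "snd \<phi> $ 0 = 0"
  shows "(u * fps_subst2 f \<phi>) $ n =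
    (\<Sum>i\<le>n. \<Sum>j\<le>n. f $ i $ j * (u * (fst \<phi> ^ i * snd \<phi> ^ j)) $ n)"
proof -
  have "(u * fps_subst2 f \<phi>) $ n =
      (\<Sum>k=0..n. \<Sum>i\<le>n. \<Sum>j\<le>n. f $ i $ j * (u $ k * (fst \<phi> ^ i * snd \<phi> ^ j) $ (n - k)))"
    unfolding fps_mult_nth[of u]
  proof (intro sum.cong refl)
    fix k assume "k \<in> {0..n}"
    then have "fps_subst2 f \<phi> $ (n - k) =
        (\<Sum>i\<le>n. \<Sum>j\<le>n. f $ i $ j * (fst \<phi> ^ i * snd \<phi> ^ j) $ (n - k))"
      by (intro fps_subst2_nth assms) auto
    then show "u $ k * fps_subst2 f \<phi> $ (n - k) =
        (\<Sum>i\<le>n. \<Sum>j\<le>n. f $ i $ j * (u $ k * (fst \<phi> ^ i * snd \<phi> ^ j) $ (n - k)))"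
      by (simp add: sum_distrib_left mult.left_commute)
  qed
  also have "\<dots> = (\<Sum>i\<le>n. \<Sum>j\<le>n. \<Sum>k=0..n. f $ i $ j * (u $ k * (fst \<phi> ^ i * snd \<phi> ^ j) $ (n - k)))"
    by (rule trans[OF sum.swap], rule sum.cong[OF refl], rule sum.swap)
  also have "\<dots> = (\<Sum>i\<le>n. \<Sum>j\<le>n. f $ i $ j * (u * (fst \<phi> ^ i * snd \<phi> ^ j)) $ n)"
    by (simp add: fps_mult_nth[of u] sum_distrib_left)
  finally show ?thesis .
qed

locale arc =
  fixes \<phi> :: "'a::comm_ring_1 fps \<times> 'a fps"
  assumes fst_0: "fst \<phi> $ 0 = 0" and snd_0: "snd \<phi> $ 0 = 0"
begin

lemma subst_zero: "fps_subst2 0 \<phi> = 0"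
  by (intro fps_ext) (simp add: fps_subst2_def)

lemma subst_add: "fps_subst2 (f + g) \<phi> = fps_subst2 f \<phi> + fps_subst2 g \<phi>"
  by (intro fps_ext) (simp add: fps_subst2_def distrib_right sum.distrib)

lemma subst_const_mult: "fps_subst2 (fps_cc a * f) \<phi> = fps_const a * fps_subst2 f \<phi>"
  by (intro fps_ext) (simp add: fps_subst2_def fps_cc_mult_nth sum_distrib_left mult.assoc)

lemma subst_var_x_mult: "fps_subst2 (var_x * f) \<phi> = fst \<phi> * fps_subst2 f \<phi>"
proof (rule fps_ext)
  fix n
  have "fps_subst2 (var_x * f) \<phi> $ n =
      (\<Sum>i\<le>Suc n. \<Sum>j\<le>n. (var_x * f) $ i $ j * (fst \<phi> ^ i * snd \<phi> ^ j) $ n)"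
    by (intro fps_subst2_nth fst_0 snd_0) auto
  also have "\<dots> = (\<Sum>i\<le>n. \<Sum>j\<le>n. f $ i $ j * (fst \<phi> * (fst \<phi> ^ i * snd \<phi> ^ j)) $ n)"
    unfolding sum.atMost_Suc_shift by (simp add: var_x_mult_nth mult.assoc del: fps_mult_nth_0)
  also have "\<dots> = (fst \<phi> * fps_subst2 f \<phi>) $ n"
    by (rule fps_subst2_mult_nth[OF fst_0 snd_0, symmetric])
  finally show "fps_subst2 (var_x * f) \<phi> $ n = (fst \<phi> * fps_subst2 f \<phi>) $ n" .
qed

lemma subst_var_y_mult: "fps_subst2 (var_y * f) \<phi> = snd \<phi> * fps_subst2 f \<phi>"
proof (rule fps_ext)
  fix n
  have "fps_subst2 (var_y * f) \<phi> $ n =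
      (\<Sum>i\<le>n. \<Sum>j\<le>Suc n. (var_y * f) $ i $ j * (fst \<phi> ^ i * snd \<phi> ^ j) $ n)"
    by (intro fps_subst2_nth fst_0 snd_0) auto
  also have "\<dots> = (\<Sum>i\<le>n. \<Sum>j\<le>n. f $ i $ j * (snd \<phi> * (fst \<phi> ^ i * snd \<phi> ^ j)) $ n)"
    unfolding sum.atMost_Suc_shift by (simp add: var_y_mult_nth_nth mult.left_commute)
  also have "\<dots> = (snd \<phi> * fps_subst2 f \<phi>) $ n"
    by (rule fps_subst2_mult_nth[OF fst_0 snd_0, symmetric])
  finally show "fps_subst2 (var_y * f) \<phi> $ n = (snd \<phi> * fps_subst2 f \<phi>) $ n" .
qed

lemma subst_one: "fps_subst2 1 \<phi> = 1"
proof (rule fps_ext)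
  fix n
  have "fps_subst2 1 \<phi> $ n = (\<Sum>i\<le>n. \<Sum>j\<le>n. if i = 0 then if j = 0 then 1 $ n else 0 else 0)"
    unfolding fps_subst2_def fps_nth_Abs_fps
    by (intro sum.cong refl) (auto simp: fps_one_nth)
  also have "\<dots> = 1 $ n" by (cases "n = 0") (auto intro!: sum.neutral simp: fps_one_nth)
  finally show "fps_subst2 1 \<phi> $ n = 1 $ n" .
qed

sublocale subst: comm_ring_hom "\<lambda>f. fps_subst2 f \<phi>"
proof
  fix f g :: "'a fps fps"
  show "fps_subst2 (f * g) \<phi> = fps_subst2 f \<phi> * fps_subst2 g \<phi>"
    by (rule fps2_hom_mult[where \<iota> = fps_const and X = "fst \<phi>" and Y = "snd \<phi>"])
      (simp_all add: subst_add subst_const_mult subst_var_x_mult subst_var_y_mult subst_one fst_0 snd_0)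
qed (simp_all add: subst_zero subst_add subst_one)

lemma subst_var_x: "fps_subst2 var_x \<phi> = fst \<phi>"
  using subst_var_x_mult[of 1] by (simp add: subst_one)

lemma subst_var_y: "fps_subst2 var_y \<phi> = snd \<phi>"
  using subst_var_y_mult[of 1] by (simp add: subst_one)

lemma dvd_subst_if_mem_mpow:
  assumes "u dvd fst \<phi>" "u dvd snd \<phi>" "f \<in> mpow s"
  shows "u ^ s dvd fps_subst2 f \<phi>"
proof -
  obtain g where g: "f = (\<Sum>i\<le>s. g i * (var_x ^ i * var_y ^ (s - i)))"
    using mpow_subset_forms[of s 0] assms(3) by (auto simp: forms_def)
  have "u ^ s dvd fst \<phi> ^ i * snd \<phi> ^ (s - i)" if "i \<le> s" for i
    using mult_dvd_mono[OF dvd_power_same[OF assms(1), of i] dvd_power_same[OF assms(2), of "s - i"]] that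
    by (simp flip: power_add)
  then show ?thesis unfolding g
    by (simp add: subst.hom_sum subst.hom_mult subst.hom_power subst_var_x subst_var_y)
      (auto intro!: dvd_sum)
qed

lemma subst_swap_vars: "fps_subst2 (swap_vars f) \<phi> = fps_subst2 f (snd \<phi>, fst \<phi>)"
  by (rule fps_ext) (simp add: fps_subst2_def, subst sum.swap, simp add: mult.commute)

end

lemma dvd_ideal_power:
  assumes "comm_ring_hom h" "\<And>f. f \<in> I \<Longrightarrow> u dvd h f" "g \<in> ideal_power I n"
  shows "u ^ n dvd h g"
proof -
  interpret comm_ring_hom h by fact
  have "ideal_power I n \<subseteq> {g. u ^ n dvd h g}"
    by (rule ideal_power_subset[where Q = "\<lambda>n. {g. u ^ n dvd h g}"])
      (auto simp: is_ideal_iff hom_zero hom_add hom_mult assms(2) mult_dvd_mono)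
  then show ?thesis using assms(3) by auto
qed

text \<open>Pull-back along the blow-up \<open>(x, t) \<mapsto> (x, x t)\<close>, with values in \<open>k[t][[x]]\<close>.\<close>

definition blowup :: "'a::comm_ring_1 fps fps \<Rightarrow> 'a poly fps" where
  "blowup f = Abs_fps (\<lambda>n. \<Sum>j\<le>n. monom (f $ (n - j) $ j) j)"

lemma coeff_blowup: "coeff (blowup f $ n) j = (if j \<le> n then f $ (n - j) $ j else 0)"
  by (simp add: blowup_def coeff_sum coeff_monom sum.delta)

lemma blowup_zero: "blowup 0 = 0"
  by (intro fps_ext poly_eqI) (simp add: coeff_blowup)

lemma blowup_add: "blowup (f + g) = blowup f + blowup g"
  by (intro fps_ext poly_eqI) (simp add: coeff_blowup)

lemma blowup_const_mult: "blowup (fps_cc a * f) = fps_const [:a:] * blowup f"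
  by (intro fps_ext poly_eqI) (simp add: coeff_blowup fps_cc_mult_nth)

lemma blowup_var_x_mult: "blowup (var_x * f) = fps_X * blowup f"
proof (intro fps_ext poly_eqI)
  fix n j
  have "n - j - Suc 0 = n - Suc 0 - j" by simp
  then show "coeff (blowup (var_x * f) $ n) j = coeff ((fps_X * blowup f) $ n) j"
    by (auto simp: coeff_blowup var_x_mult_nth)
qed

lemma blowup_var_y_mult: "blowup (var_y * f) = fps_X * fps_const [:0, 1:] * blowup f"
  by (intro fps_ext poly_eqI)
    (auto simp: coeff_blowup var_y_mult_nth_nth mult.assoc coeff_pCons split: nat.split)

lemma blowup_one: "blowup 1 = 1"
  by (intro fps_ext poly_eqI) (auto simp: coeff_blowup fps_one_nth)

interpretation blowup: comm_ring_hom "blowup :: 'a::comm_ring_1 fps fps \<Rightarrow> _"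
proof
  fix f g :: "'a fps fps"
  show "blowup (f * g) = blowup f * blowup g"
    by (rule fps2_hom_mult[where \<iota> = "\<lambda>a. fps_const [:a:]" and X = fps_X and Y = "fps_X * fps_const [:0, 1:]"])
      (simp_all add: blowup_add blowup_const_mult blowup_var_x_mult blowup_var_y_mult blowup_one)
qed (simp_all add: blowup_zero blowup_add blowup_one)

lemma blowup_var_x: "blowup var_x = fps_X"
  using blowup_var_x_mult[of 1] by (simp add: blowup_one)

lemma blowup_var_y: "blowup var_y = fps_X * fps_const [:0, 1:]"
  using blowup_var_y_mult[of 1] by (simp add: blowup_one)

text \<open>The n-th coefficient of \<open>blowup f\<close> is the homogeneous part of degree n of f
  at (1, t), from which that part can be recovered.\<close>

lemma mem_mpow_iff_blowup: "f \<in> mpow s \<longleftrightarrow> (\<forall>n<s. blowup f $ n = 0)"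
proof
  assume "f \<in> mpow s"
  then show "\<forall>n<s. blowup f $ n = 0" by (auto simp: mpow_def coeff_blowup poly_eq_iff)
next
  assume *: "\<forall>n<s. blowup f $ n = 0"
  show "f \<in> mpow s" unfolding mpow_def
  proof (safe)
    fix i j assume "i + j < s"
    then have "coeff (blowup f $ (i + j)) j = 0" using * by simp
    then show "f $ i $ j = 0" by (simp add: coeff_blowup)
  qed
qed

definition fps_map :: "('a \<Rightarrow> 'b) \<Rightarrow> 'a fps \<Rightarrow> 'b fps" where
  "fps_map h f = Abs_fps (\<lambda>n. h (f $ n))"

lemma fps_map_nth [simp]: "fps_map h f $ n = h (f $ n)"
  by (simp add: fps_map_def)

lemma comm_ring_hom_fps_map:
  assumes "comm_ring_hom h" shows "comm_ring_hom (fps_map h)"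
proof -
  interpret comm_ring_hom h by fact
  show ?thesis
    by unfold_locales
      (auto intro!: fps_ext simp: hom_add hom_sum hom_mult hom_zero hom_one fps_mult_nth fps_one_nth)
qed

lemma comm_ring_hom_comp:
  assumes "comm_ring_hom g" "comm_ring_hom h" shows "comm_ring_hom (\<lambda>x. g (h x))"
proof -
  interpret g: comm_ring_hom g by fact
  interpret h: comm_ring_hom h by fact
  show ?thesis by unfold_locales (simp_all add: g.hom_add h.hom_add g.hom_mult h.hom_mult)
qed

section \<open>Completed local rings at the points of the exceptional line\<close>

definition recenter :: "'a::comm_ring_1 \<Rightarrow> 'a poly \<Rightarrow> 'a fps" where
  "recenter c p = fps_of_poly (pcompose p [:c, 1:])"

lemma comm_ring_hom_recenter: "comm_ring_hom (recenter c)"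
  by unfold_locales
    (simp_all add: recenter_def pcompose_add pcompose_mult fps_of_poly_add fps_of_poly_mult pcompose_1)

text \<open>The map from k[[x,y]] to the completed local ring of the blow-up at the point t = c; in
  the target \<open>var_y\<close> stands for t - c.\<close>

definition chart :: "'a::comm_ring_1 \<Rightarrow> 'a fps fps \<Rightarrow> 'a fps fps" where
  "chart c f = fps_map (recenter c) (blowup f)"

lemma comm_ring_hom_map_recenter: "comm_ring_hom (fps_map (recenter c))"
  by (intro comm_ring_hom_fps_map comm_ring_hom_recenter)

interpretation recenter: comm_ring_hom "recenter c" for c :: "'a::comm_ring_1"
  by (rule comm_ring_hom_recenter)

interpretation map_recenter: comm_ring_hom "fps_map (recenter c)" for c :: "'a::comm_ring_1"
  by (rule comm_ring_hom_map_recenter)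

interpretation chart: comm_ring_hom "chart c" for c :: "'a::comm_ring_1"
  unfolding chart_def
  by (rule comm_ring_hom_comp[OF comm_ring_hom_map_recenter blowup.comm_ring_hom_axioms])

lemma recenter_X: "recenter c [:0, 1:] = fps_X + fps_const c"
  by (simp add: recenter_def pcompose_pCons fps_of_poly_pCons add.commute)

lemma recenter_const: "recenter c [:a:] = fps_const a"
  by (simp add: recenter_def)

lemma map_recenter_const: "fps_map (recenter c) (fps_const p) = fps_const (recenter c p)"
  by (auto intro!: fps_ext simp: recenter.hom_zero)

lemma map_recenter_fps_X: "fps_map (recenter c) fps_X = fps_X"
  by (auto intro!: fps_ext simp: fps_X_def recenter.hom_zero recenter.hom_one)

lemma chart_var_x: "chart c var_x = var_x"
  unfolding chart_def blowup_var_x map_recenter_fps_X by (simp add: var_x_def)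

lemma chart_var_y: "chart c var_y = var_x * (var_y + fps_cc c)"
  unfolding chart_def blowup_var_y map_recenter.hom_mult map_recenter_fps_X map_recenter_const recenter_X
  by (simp add: var_x_def var_y_def fps_cc_def flip: fps_const_add)

lemma chart_const: "chart c (fps_cc a) = fps_cc a"
proof -
  have "blowup (fps_cc a) = fps_const [:a:]"
    using blowup_const_mult[of a 1] by (simp add: blowup_one)
  then show ?thesis by (simp add: chart_def map_recenter_const recenter_const fps_cc_def)
qed

lemma subst_chart:
  assumes "fst \<psi> $ 0 = 0" "snd \<psi> $ 0 = 0"
  shows "fps_subst2 (chart c f) \<psi> = fps_subst2 f (fst \<psi>, fst \<psi> * (snd \<psi> + fps_const c))"
proof -
  interpret a: arc \<psi> by standard (fact assms)+
  interpret b: arc "(fst \<psi>, fst \<psi> * (snd \<psi> + fps_const c))" by standard (simp_all add: assms)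
  have cc: "fps_subst2 (fps_cc a) \<psi> = fps_const a" for a
    using a.subst_const_mult[of a 1] by (simp add: a.subst_one)
  show ?thesis
    by (rule fps2_hom_unique[where \<iota> = fps_const and X = "fst \<psi>" and Y = "fst \<psi> * (snd \<psi> + fps_const c)"
        and ?h1.0 = "\<lambda>f. fps_subst2 (chart c f) \<psi>"])
      (simp_all add: a.subst.hom_add a.subst.hom_mult b.subst.hom_add b.subst_const_mult b.subst_var_x_mult
        b.subst_var_y_mult chart.hom_add chart.hom_mult chart.hom_one chart_const chart_var_x chart_var_y
        a.subst_var_x a.subst_var_y cc a.subst_one b.subst_one assms)
qed

lemma subst_line: "fps_subst2 f (fps_X, fps_X * fps_const c) $ n = poly (blowup f $ n) c"
proof -
  interpret a: arc "(fps_X, fps_X * fps_const c)" by standard simp_all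
  interpret m: comm_ring_hom "fps_map (\<lambda>p. poly p c)"
    by (rule comm_ring_hom_fps_map, unfold_locales) simp_all
  have X: "fps_map (\<lambda>p. poly p c) fps_X = fps_X"
    by (auto intro!: fps_ext simp: fps_X_def)
  have C: "fps_map (\<lambda>p. poly p c) (fps_const p) = fps_const (poly p c)" for p
    by (auto intro!: fps_ext)
  have "fps_subst2 f (fps_X, fps_X * fps_const c) = fps_map (\<lambda>p. poly p c) (blowup f)"
    by (rule fps2_hom_unique[where \<iota> = fps_const and X = fps_X and Y = "fps_X * fps_const c"
        and ?h2.0 = "\<lambda>f. fps_map (\<lambda>p. poly p c) (blowup f)"])
      (simp_all add: a.subst_add a.subst_const_mult a.subst_var_x_mult a.subst_var_y_mult a.subst_one
        blowup_add blowup_const_mult blowup_var_x_mult blowup_var_y_mult blowup_one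
        m.hom_add m.hom_mult m.hom_one X C mult.assoc)
  then show ?thesis by simp
qed

subsection \<open>Descent of integral dependence along the blow-up\<close>

text \<open>A generator of the principal ideal \<open>Q\<close> has no root, hence is constant. This
  patches local statements at the points c of the exceptional line into one over k[t].\<close>

lemma poly_ideal_one_mem:
  fixes Q :: "'a::alg_closed_field poly set"
  assumes Q: "is_ideal Q" and nz: "\<And>c. \<exists>p\<in>Q. poly p c \<noteq> 0"
  shows "1 \<in> Q"
proof -
  obtain p0 where "p0 \<in> Q" "poly p0 0 \<noteq> 0" using nz by blast
  then have "\<exists>p. p \<in> Q \<and> p \<noteq> 0" by auto
  then obtain p where p: "p \<in> Q" "p \<noteq> 0"
    and min: "\<And>q. q \<in> Q \<Longrightarrow> q \<noteq> 0 \<Longrightarrow> degree p \<le> degree q"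
    using ex_has_least_nat[of "\<lambda>p. p \<in> Q \<and> p \<noteq> 0" _ degree] by blast
  have dvd: "p dvd q" if "q \<in> Q" for q
  proof -
    have "q mod p = q - (q div p) * p" by (simp add: minus_div_mult_eq_mod)
    then have "q mod p \<in> Q" using that p Q by (auto intro!: ideal_diff ideal_multL)
    then have "q mod p = 0" using min degree_mod_less'[OF p(2)] by (metis leD)
    then show ?thesis by auto
  qed
  have "degree p = 0"
  proof (rule ccontr)
    assume "degree p \<noteq> 0"
    then obtain c where c: "poly p c = 0" using alg_closed_imp_poly_has_root[of p] by auto
    obtain q where "q \<in> Q" "poly q c \<noteq> 0" using nz by blast
    with dvd[of q] c show False by (auto elim!: dvdE)
  qed
  then obtain a where a: "p = [:a:]" by (rule degree_eq_zeroE)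
  have "[:inverse a:] * p \<in> Q" by (rule ideal_multL[OF Q p(1)])
  moreover have "[:inverse a:] * p = 1" using p a by (simp add: pCons_one)
  ultimately show ?thesis by simp
qed

lemma comm_ring_hom_pcompose: "comm_ring_hom (\<lambda>p. pcompose p q)"
  by unfold_locales (simp_all add: pcompose_add pcompose_mult pcompose_1)

lemma pcompose_recenter_inverse:
  fixes p :: "'a::comm_ring_1 poly"
  shows "pcompose (pcompose p [:- c, 1:]) [:c, 1:] = p"
    and "pcompose (pcompose p [:c, 1:]) [:- c, 1:] = p"
  by (simp_all add: pcompose_assoc[symmetric] pcompose_pCons pcompose_idR)

text \<open>Together with \<open>dvd_if_recenter_dvd\<close> this says that k[t] and its completion
  at c agree modulo (t - c)^m. The polynomial is the truncation of f, rewritten from t - c to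
  t.\<close>

lemma recenter_split:
  obtains p s where "f = recenter c p + fps_X ^ m * s"
proof
  let ?p = "\<Sum>l<m. monom (f $ l) l"
  have "fps_of_poly ?p = fps_cutoff m f"
    by (intro fps_ext) (auto simp: coeff_sum coeff_monom sum.delta)
  then have "recenter c (pcompose ?p [:- c, 1:]) = fps_cutoff m f"
    by (simp add: recenter_def pcompose_recenter_inverse)
  then show "f = recenter c (pcompose ?p [:- c, 1:]) + fps_X ^ m * fps_shift m f"
    using fps_shift_cutoff[of m f] by (simp add: algebra_simps)
qed

lemma dvd_if_recenter_dvd:
  fixes p :: "'a::idom poly"
  assumes "recenter c p = fps_X ^ m * s"
  shows "[:- c, 1:] ^ m dvd p"
proof -
  interpret comp: comm_ring_hom "\<lambda>p. pcompose p [:- c, 1:]" by (rule comm_ring_hom_pcompose)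
  let ?q = "pcompose p [:c, 1:]"
  have "coeff ?q k = 0" if "k < m" for k
    using assms that unfolding recenter_def fps_eq_iff by (auto simp: fps_X_power_mult_nth dest!: spec[of _ k])
  then have "monom 1 m dvd ?q" by (simp add: monom_1_dvd_iff')
  then obtain w where "?q = monom 1 m * w" by (elim dvdE)
  then have "pcompose ?q [:- c, 1:] = pcompose (monom 1 m) [:- c, 1:] * pcompose w [:- c, 1:]"
    by (simp add: comp.hom_mult)
  then have "p = pcompose (monom 1 m) [:- c, 1:] * pcompose w [:- c, 1:]"
    by (simp add: pcompose_recenter_inverse)
  moreover have "pcompose (monom 1 m) [:- c, 1:] = [:- c, 1:] ^ m"
    by (simp add: monom_altdef comp.hom_power pcompose_pCons)
  ultimately show ?thesis by simp
qed

lemma fps_X_power_dvd_iff_nth: "fps_X ^ n dvd f \<longleftrightarrow> (\<forall>k<n. f $ k = 0)" for f :: "'a::comm_ring_1 fps"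
proof
  assume "\<forall>k<n. f $ k = 0"
  then have "f = fps_X ^ n * fps_shift n f" by (intro fps_ext) (auto simp: fps_X_power_mult_nth)
  then show "fps_X ^ n dvd f" by (rule dvdI)
qed (auto elim!: dvdE simp: fps_X_power_mult_nth)

lemma fps_const_dvd_if_nth_dvd:
  assumes "\<And>i. a dvd f $ i" shows "fps_const a dvd f"
proof -
  obtain g where "\<And>i. f $ i = a * g i" using assms unfolding dvd_def by metis
  then have "f = fps_const a * Abs_fps g" by (intro fps_ext) simp
  then show ?thesis by (rule dvdI)
qed

lemma ideal_gen_blowup_dvd:
  assumes "J \<subseteq> mpow d" "v \<in> ideal_gen (blowup ` J)"
  shows "fps_X ^ d dvd v"
proof -
  have "fps_X ^ d dvd blowup j" if "j \<in> J" for j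
    using assms(1) that unfolding fps_X_power_dvd_iff_nth mem_mpow_iff_blowup[symmetric] by blast
  then have "ideal_gen (blowup ` J) \<subseteq> {v. fps_X ^ d dvd v}"
    by (intro ideal_gen_least) (auto simp: is_ideal_iff)
  then show ?thesis using assms(2) by auto
qed

text \<open>Passing from the complete local ring at the point \<open>t = c\<close> of the exceptional line
  back to \<open>k[t][[x]]\<close>: the power of \<open>t - c\<close> in \<open>F\<close> absorbs the truncation of coefficients.\<close>

lemma descent_at_point:
  fixes J :: "'a::field fps fps set"
  assumes J: "J \<subseteq> mpow d" and g: "g \<in> mpow d"
    and mem: "chart c g \<in> ideal_gen (chart c ` J)"
    and F: "F \<noteq> 0" "fps_X ^ d * fps_const F \<in> ideal_gen (blowup ` J)"
  shows "\<exists>G. poly G c \<noteq> 0 \<and> fps_const G * blowup g \<in> ideal_gen (blowup ` J)"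
proof -
  let ?J = "ideal_gen (blowup ` J)" and ?h = "fps_map (recenter c)"
  have idJ: "is_ideal ?J" by (rule is_ideal_ideal_gen)
  \<comment> \<open>The part G of F prime to t - c is the required witness, and m is the precision
    in t - c to which multipliers may be truncated.\<close>
  obtain m G where G: "F = [:- c, 1:] ^ m * G" "\<not> [:- c, 1:] dvd G"
    using order_decomp[OF F(1), of c] by blast
  \<comment> \<open>Truncating the power series multipliers gives a v in \<open>?J\<close> that
    agrees with w up to (t - c)^m. The error keeps the factor x^d, which divides every generator;
    the factor is needed to meet x^d F later.\<close>
  have "\<exists>v\<in>?J. \<exists>s. w - ?h v = fps_X ^ d * (fps_const (fps_X ^ m) * s)"
    if "w \<in> ideal_gen (chart c ` J)" for w
    using that
  proof (induction rule: ideal_gen_induct)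
    case zero
    show ?case using ideal_zeroI[OF idJ]
      by (intro bexI[of _ 0] exI[of _ 0]) (simp_all add: map_recenter.hom_zero)
  next
    case (step r a x)
    then obtain j where j: "a = chart c j" "j \<in> J" by auto
    obtain v s where v: "v \<in> ?J" "x - ?h v = fps_X ^ d * (fps_const (fps_X ^ m) * s)" using step by blast
    obtain j' where j': "blowup j = fps_X ^ d * j'"
      using ideal_gen_blowup_dvd[OF J, of "blowup j"] j(2) by (auto intro: ideal_gen_base elim!: dvdE)
    have "\<exists>p s. r $ i = recenter c p + fps_X ^ m * s" for i by (rule recenter_split) blast
    then obtain p q where pq: "\<And>i. r $ i = recenter c (p i) + fps_X ^ m * q i" by metis
    have r: "r = ?h (Abs_fps p) + fps_const (fps_X ^ m) * Abs_fps q"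
      by (intro fps_ext) (simp add: pq)
    have a: "a = fps_X ^ d * ?h j'"
      unfolding j chart_def j' by (simp add: map_recenter.hom_mult map_recenter.hom_power map_recenter_fps_X)
    have "r * a + x - ?h (Abs_fps p * blowup j + v) =
        fps_X ^ d * (fps_const (fps_X ^ m) * (Abs_fps q * ?h j' + s))"
    proof -
      have "?h (Abs_fps p * blowup j) = ?h (Abs_fps p) * a"
        by (simp add: map_recenter.hom_mult j chart_def)
      then have "r * a + x - ?h (Abs_fps p * blowup j + v) =
          fps_const (fps_X ^ m) * Abs_fps q * a + (x - ?h v)"
        by (simp add: map_recenter.hom_add r algebra_simps)
      then show ?thesis unfolding v a by (simp add: algebra_simps)
    qed
    moreover have "Abs_fps p * blowup j + v \<in> ?J"
      using ideal_add[OF idJ ideal_multL[OF idJ ideal_gen_base] v(1)] j(2) by blast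
    ultimately show ?case by blast
  qed
  from this[OF mem] obtain v s where v: "v \<in> ?J"
      "?h (blowup g - v) = fps_X ^ d * (fps_const (fps_X ^ m) * s)"
    unfolding chart_def map_recenter.hom_minus by blast
  have "fps_X ^ d dvd blowup g - v"
    using ideal_gen_blowup_dvd[OF J v(1)] g
    by (auto simp: fps_X_power_dvd_iff_nth mem_mpow_iff_blowup)
  then obtain e where e: "blowup g - v = fps_X ^ d * e" by (elim dvdE)
  have "fps_X ^ d * ?h e = fps_X ^ d * (fps_const (fps_X ^ m) * s)"
    using v(2) unfolding e by (simp add: map_recenter.hom_mult map_recenter.hom_power map_recenter_fps_X)
  then have he: "?h e = fps_const (fps_X ^ m) * s" by simp
  have "[:- c, 1:] ^ m dvd e $ i" for i
  proof (rule dvd_if_recenter_dvd)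
    show "recenter c (e $ i) = fps_X ^ m * s $ i" using arg_cong[OF he, of "\<lambda>f. f $ i"] by simp
  qed
  then obtain e' where e': "e = fps_const ([:- c, 1:] ^ m) * e'"
    using fps_const_dvd_if_nth_dvd by (metis dvdE)
  \<comment> \<open>Since e is divisible by (t - c)^m, multiplication by G completes the factor F,
    and x^d F lies in \<open>?J\<close>.\<close>
  have "fps_const G * (blowup g - v) = e' * (fps_X ^ d * fps_const F)"
    unfolding e e' G(1) fps_const_mult[symmetric] by (simp only: ac_simps)
  then have "fps_const G * (blowup g - v) \<in> ?J" using ideal_multL[OF idJ F(2)] by simp
  then have "fps_const G * (blowup g - v) + fps_const G * v \<in> ?J"
    by (rule ideal_add[OF idJ _ ideal_multL[OF idJ v(1)]])
  then have "fps_const G * blowup g \<in> ?J" by (simp add: algebra_simps)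
  moreover have "poly G c \<noteq> 0" using G(2) by (simp add: poly_eq_0_iff_dvd)
  ultimately show ?thesis by blast
qed

text \<open>Write the pull-back of f as x^r u; then x^(r n) u^n and x^M lie in the extension. The
  initial form at (1, t) is u minus a multiple of x, so its power n + M lies in the ideal generated
  by u^n and x^M. This supplies F for \<open>descent_at_point\<close>.\<close>

lemma initial_form_power_mem:
  assumes f: "f \<in> mpow r" "f ^ n \<in> J" and x: "var_x ^ M \<in> J"
  shows "fps_X ^ (r * n) * fps_const ((blowup f $ r) ^ (n + M)) \<in> ideal_gen (blowup ` J)"
proof -
  let ?J = "ideal_gen (blowup ` J)" and ?K = "{w. fps_X ^ (r * n) * w \<in> ideal_gen (blowup ` J)}"
  have idJ: "is_ideal ?J" by (rule is_ideal_ideal_gen)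
  then have K: "is_ideal ?K"
    unfolding is_ideal_iff by (auto simp: distrib_left mult.left_commute[of "fps_X ^ (r * n)"])
  have "fps_X ^ r dvd blowup f" using f(1) by (simp add: fps_X_power_dvd_iff_nth mem_mpow_iff_blowup)
  then obtain u where u: "blowup f = fps_X ^ r * u" by (elim dvdE)
  have "blowup (f ^ n) \<in> ?J" "blowup (var_x ^ M) \<in> ?J" using f(2) x by (auto intro: ideal_gen_base)
  then have 1: "u ^ n \<in> ?K" and "fps_X ^ M \<in> ?J"
    by (auto simp: blowup.hom_power u blowup_var_x power_mult_distrib power_mult)
  then have 2: "fps_X ^ M \<in> ?K" using ideal_multL[OF idJ] by auto
  have "u = fps_const (u $ 0) + fps_X * fps_shift 1 u"
    by (intro fps_ext) auto
  then have "fps_const (u $ 0) = u + (- fps_X * fps_shift 1 u)" by (simp add: algebra_simps)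
  moreover have "(- fps_X * fps_shift 1 u) ^ M = (- fps_shift 1 u) ^ M * fps_X ^ M"
    by (simp only: power_mult_distrib[symmetric]) (simp add: mult.commute)
  ultimately have "fps_const (u $ 0) ^ (n + M) \<in> ?K"
    using ideal_add_power_mem[OF K 1, of "- fps_X * fps_shift 1 u" M] ideal_multL[OF K 2]
    by metis
  moreover have "u $ 0 = blowup f $ r" unfolding u by (simp add: fps_X_power_mult_nth)
  ultimately show ?thesis by (simp add: fps_const_power)
qed

lemma fps_mult_nth_eq_0_if: "(\<And>n. n < N \<Longrightarrow> a $ n = 0) \<Longrightarrow> n < N \<Longrightarrow> (a * b) $ n = 0"
  for a :: "'a::comm_ring_1 fps"
  by (auto simp: fps_mult_nth intro!: sum.neutral)

text \<open>In a pull-back from k[[x,y]] the exponent of t never exceeds that of x. Multiplication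
  by x^s repairs this for the finitely many coefficients that matter; the rest has order at least s
  + M and lies in J (x, y)^s, as J contains (x, y)^M.\<close>

lemma mem_forms_if_blowup_mem:
  assumes J: "is_ideal J" "mpow M \<subseteq> J" and g: "blowup g \<in> ideal_gen (blowup ` J)"
  shows "\<exists>s0. \<forall>s\<ge>s0. var_x ^ s * g \<in> forms J s"
proof -
  have "\<exists>s0. \<forall>s\<ge>s0. \<exists>h\<in>forms J s. \<forall>n<s+M. (fps_X ^ s * w - blowup h) $ n = 0"
    if "w \<in> ideal_gen (blowup ` J)" for w
    using that
  proof (induction rule: ideal_gen_induct)
    case zero
    show ?case using ideal_zeroI[OF is_ideal_forms[OF J(1)]]
      by (auto intro!: bexI[of _ 0] simp: blowup.hom_zero)
  next
    case (step r a x)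
    then obtain j where j: "a = blowup j" "j \<in> J" by auto
    obtain s0 where s0: "\<And>s. s \<ge> s0 \<Longrightarrow> \<exists>h\<in>forms J s. \<forall>n<s+M. (fps_X ^ s * x - blowup h) $ n = 0"
      using step by blast
    \<comment> \<open>Only the first M coefficients of r in x must be represented exactly, so their
      degrees in t are bounded.\<close>
    define D where "D = (\<Sum>i<M. degree (r $ i))"
    have D: "degree (r $ i) \<le> D" if "i < M" for i
      using that unfolding D_def by (intro member_le_sum) auto
    have "\<exists>h\<in>forms J s. \<forall>n<s+M. (fps_X ^ s * (r * a + x) - blowup h) $ n = 0" if s: "s \<ge> max s0 D" for s
    proof -
      obtain h where h: "h \<in> forms J s" "\<And>n. n < s + M \<Longrightarrow> (fps_X ^ s * x - blowup h) $ n = 0"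
        using s0[of s] s by auto
      \<comment> \<open>The term t^j x^k of x^s r is the pull-back of x^(k-j) y^j. Hence i + j is
        the exponent of x in the chart, and i + j - s the index in r.\<close>
      define q where "q = Abs_fps (\<lambda>i. Abs_fps (\<lambda>j. if s \<le> i + j then coeff (r $ (i + j - s)) j else 0))"
      have q: "q \<in> mpow s" by (auto simp: q_def mpow_def)
      have "(fps_X ^ s * r - blowup q) $ n = 0" if n: "n < s + M" for n
      proof -
        have "coeff (r $ (n - s)) l = 0" if "s \<le> n" "n < l" for l
        proof (rule coeff_eq_0)
          have "n - s < M" using n that by linarith
          then show "degree (r $ (n - s)) < l" using D[of "n - s"] s that by simp
        qed
        then show ?thesis
          by (auto intro!: poly_eqI simp: fps_X_power_mult_nth coeff_blowup q_def)
      qed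
      then have "((fps_X ^ s * r - blowup q) * a + (fps_X ^ s * x - blowup h)) $ n = 0" if "n < s + M" for n
        using fps_mult_nth_eq_0_if[of "s + M" "fps_X ^ s * r - blowup q" n a] h(2)[OF that] that
        by (simp del: fps_sub_nth)
      moreover have "(fps_X ^ s * r - blowup q) * a + (fps_X ^ s * x - blowup h) =
          fps_X ^ s * (r * a + x) - blowup (q * j + h)"
        by (simp add: blowup.hom_add blowup.hom_mult j algebra_simps)
      moreover have "q * j + h \<in> forms J s"
        using mult_mem_forms[OF J(1) j(2) q] h(1) by (intro ideal_add is_ideal_forms J(1))
      ultimately show ?thesis by metis
    qed
    then show ?case by blast
  qed
  then obtain s0 where s0: "\<And>s. s \<ge> s0 \<Longrightarrow> \<exists>h\<in>forms J s. \<forall>n<s+M. (fps_X ^ s * blowup g - blowup h) $ n = 0"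
    using g by blast
  have "var_x ^ s * g \<in> forms J s" if "s \<ge> s0" for s
  proof -
    obtain h where h: "h \<in> forms J s" "\<forall>n<s+M. (fps_X ^ s * blowup g - blowup h) $ n = 0"
      using s0 \<open>s \<ge> s0\<close> by blast
    then have "var_x ^ s * g - h \<in> mpow (s + M)"
      unfolding mem_mpow_iff_blowup by (simp add: blowup.hom_minus blowup.hom_mult blowup.hom_power blowup_var_x)
    then have "var_x ^ s * g - h \<in> forms J s" using mpow_subset_forms forms_mono[OF J(2)] by blast
    then have "(var_x ^ s * g - h) + h \<in> forms J s" using h(1) by (intro ideal_add is_ideal_forms J(1))
    then show ?thesis by simp
  qed
  then show ?thesis by blast
qed

lemma ideal_gen_blowup_dep_mono:
  assumes "w \<in> ideal_gen (blowup ` dep I z n)"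
  shows "w * blowup (z ^ k) \<in> ideal_gen (blowup ` dep I z (n + k))"
  using assms
proof (induction rule: ideal_gen_induct)
  case zero
  then show ?case by (simp add: ideal_zeroI is_ideal_ideal_gen)
next
  case (step r a x)
  then obtain j where j: "a = blowup j" "j \<in> dep I z n" by auto
  have "(r * a + x) * blowup (z ^ k) = r * blowup (j * z ^ k) + x * blowup (z ^ k)"
    by (simp add: j blowup.hom_mult algebra_simps)
  moreover have "blowup (j * z ^ k) \<in> ideal_gen (blowup ` dep I z (n + k))"
    using dep_mult_power[OF j(2), of k] by (intro ideal_gen_base imageI)
  ultimately show ?case
    using ideal_add[OF is_ideal_ideal_gen ideal_multL[OF is_ideal_ideal_gen] step(2)] by simp
qed

lemma chart_descent:
  fixes z :: "'a::alg_closed_field fps fps"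
  assumes I: "is_ideal I" "mpow K \<subseteq> I" "I \<subseteq> mpow r" "\<not> I \<subseteq> mpow (Suc r)" and z: "z \<in> mpow r"
    and int: "\<And>c. chart c z \<in> ideal_integral_closure (ideal_gen (chart c ` I))"
  shows "\<exists>n\<ge>1. \<exists>s0. \<forall>s\<ge>s0. var_x ^ s * z ^ n \<in> forms (dep I z n) s"
proof -
  let ?J = "\<lambda>n. ideal_gen (blowup ` dep I z n)"
  have idJ: "is_ideal (?J n)" for n by (rule is_ideal_ideal_gen)
  obtain f where f: "f \<in> I" "f \<notin> mpow (Suc r)" using I(4) by blast
  then have fr: "f \<in> mpow r" using I(3) by blast
  then have F: "blowup f $ r \<noteq> 0" using f(2) by (auto simp: mem_mpow_iff_blowup less_Suc_eq)
  have K: "mpow (K * n) \<subseteq> dep I z n" if "n \<ge> 1" for n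
    using mpow_subset_ideal_power[OF I(1,2), of n] ideal_power_subset_dep[OF that, of I z] by blast
  \<comment> \<open>The degree n found at a point depends on c. Multiplication by powers of z raises
    it, so the G of all degrees form a single ideal.\<close>
  define Q where "Q = {G. \<exists>n\<ge>1. fps_const G * blowup (z ^ n) \<in> ?J n}"
  have mono: "fps_const G * blowup (z ^ (n + k)) \<in> ?J (n + k)" if "fps_const G * blowup (z ^ n) \<in> ?J n" for G n k
    using ideal_gen_blowup_dep_mono[OF that, of k] by (simp add: blowup.hom_mult power_add mult.assoc)
  have "is_ideal Q"
    unfolding is_ideal_iff
  proof (intro conjI ballI allI)
    show "0 \<in> Q" unfolding Q_def using ideal_zeroI[OF idJ] by auto
  next
    fix G H assume "G \<in> Q" "H \<in> Q"
    then obtain m n where mn: "m \<ge> 1" "fps_const G * blowup (z ^ m) \<in> ?J m"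
      "n \<ge> 1" "fps_const H * blowup (z ^ n) \<in> ?J n" by (auto simp: Q_def)
    have "fps_const G * blowup (z ^ (m + n)) + fps_const H * blowup (z ^ (m + n)) \<in> ?J (m + n)"
      using mono[OF mn(2), of n] mono[OF mn(4), of m] by (intro ideal_add idJ) (simp_all add: add.commute)
    then have "fps_const (G + H) * blowup (z ^ (m + n)) \<in> ?J (m + n)"
      by (simp add: distrib_right flip: fps_const_add)
    moreover have "m + n \<ge> 1" using mn by simp
    ultimately show "G + H \<in> Q" unfolding Q_def by blast
  next
    fix R G assume "G \<in> Q"
    then obtain n where n: "n \<ge> 1" "fps_const G * blowup (z ^ n) \<in> ?J n" by (auto simp: Q_def)
    have "fps_const (R * G) * blowup (z ^ n) \<in> ?J n"
      using ideal_multL[OF idJ n(2), of "fps_const R"] by (simp only: fps_const_mult[symmetric] mult.assoc)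
    then show "R * G \<in> Q" unfolding Q_def using n(1) by blast
  qed
  moreover have "\<exists>G\<in>Q. poly G c \<noteq> 0" for c
  proof -
    obtain n where n: "n \<ge> 1" "chart c z ^ n \<in> dep (ideal_gen (chart c ` I)) (chart c z) n"
      using int[of c] by (auto simp: integral_closure_iff_dep)
    have "chart c (z ^ n) \<in> ideal_gen (chart c ` dep I z n)"
      using n(2) chart.dep_hom[of c I z n] by (auto simp: chart.hom_power)
    moreover have "f ^ n \<in> dep I z n"
      using power_mem_ideal_power[OF f(1)] ideal_power_subset_dep[OF n(1)] by blast
    moreover have "var_x ^ (K * n) \<in> dep I z n"
      using K[OF n(1)] power_mem_mpow[OF vars_mem_mpow(1), of "K * n"] by auto
    ultimately have "\<exists>G. poly G c \<noteq> 0 \<and> fps_const G * blowup (z ^ n) \<in> ?J n"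
      using F by (intro descent_at_point[where d = "r * n" and F = "(blowup f $ r) ^ (n + K * n)"]
        initial_form_power_mem[where f = f and M = "K * n"] dep_subset_mpow power_mem_mpow fr I(3) z) auto
    then show ?thesis unfolding Q_def using n(1) by blast
  qed
  ultimately have "1 \<in> Q" by (rule poly_ideal_one_mem)
  then obtain n where n: "n \<ge> 1" "blowup (z ^ n) \<in> ?J n" by (auto simp: Q_def)
  then show ?thesis using mem_forms_if_blowup_mem[OF is_ideal_dep K[OF n(1)] n(2)] by blast
qed

lemma forms_dep_mult_power:
  assumes "a \<in> forms (dep I z n) s"
  shows "a * z ^ k \<in> forms (dep I z (n + k)) s"
proof -
  obtain g where g: "a = (\<Sum>i\<le>s. g i * (var_x ^ i * var_y ^ (s - i)))" "\<forall>i\<le>s. g i \<in> dep I z n"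
    using assms by (auto simp: forms_def)
  have "a * z ^ k = (\<Sum>i\<le>s. (g i * z ^ k) * (var_x ^ i * var_y ^ (s - i)))"
    unfolding g(1) sum_distrib_right by (simp add: algebra_simps)
  then show ?thesis unfolding forms_def using g(2) dep_mult_power[of _ I z n k]
    by (auto intro!: exI[of _ "\<lambda>i. g i * z ^ k"])
qed

lemma integral_closure_descent:
  fixes z :: "'a::alg_closed_field fps fps"
  assumes I: "is_ideal I" "mpow K \<subseteq> I" "I \<subseteq> mpow r" "\<not> I \<subseteq> mpow (Suc r)" and z: "z \<in> mpow r"
    and int1: "\<And>c. chart c z \<in> ideal_integral_closure (ideal_gen (chart c ` I))"
    and int2: "\<And>c. chart c (swap_vars z) \<in> ideal_integral_closure (ideal_gen (chart c ` swap_vars ` I))"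
  shows "z \<in> ideal_integral_closure I"
proof -
  obtain n1 s1 where 1: "n1 \<ge> 1" "\<And>s. s \<ge> s1 \<Longrightarrow> var_x ^ s * z ^ n1 \<in> forms (dep I z n1) s"
    using chart_descent[OF I z int1] by blast
  have "\<exists>n\<ge>1. \<exists>s0. \<forall>s\<ge>s0. var_x ^ s * (swap_vars z) ^ n \<in> forms (dep (swap_vars ` I) (swap_vars z) n) s"
  proof (rule chart_descent[OF is_ideal_swap[OF I(1)], where K = K and r = r])
    show "mpow K \<subseteq> swap_vars ` I" using I(2) by (auto simp: swap_image_eq swap_mem_mpow)
  qed (use I z int2 in \<open>auto simp: swap_mem_mpow image_subset_iff\<close>)
  then obtain n2 s2 where 2: "n2 \<ge> 1"
    "\<And>s. s \<ge> s2 \<Longrightarrow> var_x ^ s * (swap_vars z) ^ n2 \<in> forms (dep (swap_vars ` I) (swap_vars z) n2) s" by blast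
  define n s where "n = n1 + n2" and "s = max s1 s2"
  let ?J = "dep I z n"
  have idJ: "is_ideal ?J" by (rule is_ideal_dep)
  have x: "var_x ^ s * z ^ n \<in> forms ?J s"
    using forms_dep_mult_power[OF 1(2)[of s], of n2] by (simp add: n_def s_def power_add mult.assoc)
  have "var_x ^ s * (swap_vars z) ^ n2 \<in> swap_vars ` forms (dep I z n2) s"
    using 2(2)[of s] forms_mono[OF dep_swap_subset[of I z n2], of s] forms_swap_subset[OF is_ideal_dep[of I z n2], of s]
    by (auto simp: s_def)
  then have "swap_vars (var_x ^ s * (swap_vars z) ^ n2) \<in> forms (dep I z n2) s"
    unfolding swap_image_eq by simp
  then have "var_y ^ s * z ^ n2 \<in> forms (dep I z n2) s"
    by (simp add: swap.hom_mult swap.hom_power swap_var_x)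
  from forms_dep_mult_power[OF this, of n1] have y: "var_y ^ s * z ^ n \<in> forms ?J s"
    by (simp only: n_def mult.assoc flip: power_add) (simp only: add.commute)
  \<comment> \<open>In degree 2 s every monomial is divisible by x^s or y^s, so the estimates from
    both charts apply. These monomials form the vector for the determinant trick.\<close>
  have "z ^ n * (var_x ^ i * var_y ^ (2 * s - i)) \<in> forms ?J (2 * s)" if "i < Suc (2 * s)" for i
  proof (cases "s \<le> i")
    case True
    have e: "i - s + (2 * s - i) + s = 2 * s" using True that by simp
    have "var_x ^ (i - s) * var_y ^ (2 * s - i) * (var_x ^ s * z ^ n) \<in> forms ?J (2 * s)"
      using forms_mult_monom[OF idJ x, of "i - s" "2 * s - i"] unfolding e .
    moreover have "var_x ^ i = var_x ^ (i - s) * (var_x ^ s :: 'a fps fps)"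
      using True by (simp flip: power_add)
    ultimately show ?thesis by (simp only: ac_simps)
  next
    case False
    have e: "i + (s - i) + s = 2 * s" using False by simp
    have "var_x ^ i * var_y ^ (s - i) * (var_y ^ s * z ^ n) \<in> forms ?J (2 * s)"
      using forms_mult_monom[OF idJ y, of i "s - i"] unfolding e .
    moreover have "var_y ^ (2 * s - i) = var_y ^ (s - i) * (var_y ^ s :: 'a fps fps)"
      using False by (simp add: mult_2 flip: power_add)
    ultimately show ?thesis by (simp only: ac_simps)
  qed
  then have ex: "\<exists>b. z ^ n * (var_x ^ i * var_y ^ (2 * s - i)) =
        (\<Sum>j\<le>2 * s. b j * (var_x ^ j * var_y ^ (2 * s - j))) \<and> (\<forall>j\<le>2 * s. b j \<in> ?J)"
    if "i < Suc (2 * s)" for i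
    using that unfolding forms_def mem_Collect_eq .
  have "\<forall>i\<in>{..<Suc (2 * s)}. \<exists>b. z ^ n * (var_x ^ i * var_y ^ (2 * s - i)) =
        (\<Sum>j\<le>2 * s. b j * (var_x ^ j * var_y ^ (2 * s - j))) \<and> (\<forall>j\<le>2 * s. b j \<in> ?J)"
    by (intro ballI ex) (simp only: lessThan_iff)
  from bchoice[OF this] obtain b where b: "\<forall>i\<in>{..<Suc (2 * s)}.
      z ^ n * (var_x ^ i * var_y ^ (2 * s - i)) = (\<Sum>j\<le>2 * s. b i j * (var_x ^ j * var_y ^ (2 * s - j)))
      \<and> (\<forall>j\<le>2 * s. b i j \<in> ?J)" by (rule exE)
  show ?thesis
  proof (rule integral_closure_if_stable)
    show "z ^ n * (var_x ^ i * var_y ^ (2 * s - i)) =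
        (\<Sum>j<Suc (2 * s). b i j * (var_x ^ j * var_y ^ (2 * s - j)))" if "i < Suc (2 * s)" for i
      using bspec[OF b, of i] that
      by (simp only: lessThan_Suc_atMost lessThan_iff atMost_iff less_Suc_eq_le)
    show "b i j \<in> ?J" if "i < Suc (2 * s)" "j < Suc (2 * s)" for i j
      using bspec[OF b, of i] that by (simp only: less_Suc_eq_le lessThan_iff)
    show "0 < Suc (2 * s)" "1 \<le> n" using 1(1) by (simp_all add: n_def)
    show "var_x ^ 0 * var_y ^ (2 * s - 0) \<noteq> (0 :: 'a fps fps)" by (simp add: var_y_def)
  qed
qed

subsection \<open>The arc criterion for integral dependence\<close>

text \<open>Divisibility for all d says that the order of z along the arc is at least the smallest
  order found in \<open>I\<close>, infinite orders included. Requiring both components to be nonzero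
  gives a class of arcs stable under the swap and under (u, v) to (u, u (v + c)), where u^r has to
  be cancelled.\<close>

definition arc_dominated :: "'a::field fps fps set \<Rightarrow> 'a fps fps \<Rightarrow> bool" where
  "arc_dominated I z \<longleftrightarrow> (\<forall>u v d. u \<noteq> 0 \<longrightarrow> v \<noteq> 0 \<longrightarrow> u $ 0 = 0 \<longrightarrow> v $ 0 = 0 \<longrightarrow>
     (\<forall>f\<in>I. fps_X ^ d dvd fps_subst2 f (u, v)) \<longrightarrow> fps_X ^ d dvd fps_subst2 z (u, v))"

lemma arc_dominatedD:
  assumes "arc_dominated I z" "u \<noteq> 0" "v \<noteq> 0" "u $ 0 = 0" "v $ 0 = 0"
    "\<And>f. f \<in> I \<Longrightarrow> fps_X ^ d dvd fps_subst2 f (u, v)"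
  shows "fps_X ^ d dvd fps_subst2 z (u, v)"
  using assms unfolding arc_dominated_def by blast

lemma arc_dominated_swap:
  assumes "arc_dominated I z" shows "arc_dominated (swap_vars ` I) (swap_vars z)"
  unfolding arc_dominated_def
proof (intro allI impI)
  fix u v :: "'a fps" and d
  assume *: "u \<noteq> 0" "v \<noteq> 0" "u $ 0 = 0" "v $ 0 = 0"
    "\<forall>f\<in>swap_vars ` I. fps_X ^ d dvd fps_subst2 f (u, v)"
  interpret a: arc "(u, v)" using * by unfold_locales auto
  have sw: "fps_subst2 (swap_vars f) (u, v) = fps_subst2 f (v, u)" for f
    using a.subst_swap_vars by simp
  show "fps_X ^ d dvd fps_subst2 (swap_vars z) (u, v)"
    unfolding sw by (rule arc_dominatedD[OF assms]) (use * sw in auto)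
qed

text \<open>A line in general direction detects the order: its slope c only has to avoid the roots
  of the homogeneous part of z in question.\<close>

lemma mem_mpow_if_arc_dominated:
  fixes z :: "'a::alg_closed_field fps fps"
  assumes dom: "arc_dominated I z" and I: "I \<subseteq> mpow r"
  shows "z \<in> mpow r"
  unfolding mem_mpow_iff_blowup
proof (intro allI impI, rule ccontr)
  fix d assume d: "d < r" and nz: "blowup z $ d \<noteq> 0"
  let ?p = "blowup z $ d"
  \<comment> \<open>A root c of 1 + t p(t) is neither 0 nor a root of p. So the arc has nonzero
    second component and the coefficient of degree d survives along it.\<close>
  have "degree (1 + [:0, 1:] * ?p) > 0"
    using nz by (subst degree_add_eq_right) (auto simp: degree_mult_eq)
  then obtain c where "poly (1 + [:0, 1:] * ?p) c = 0" using alg_closed_imp_poly_has_root by blast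
  then have c: "1 + c * poly ?p c = 0" by simp
  then have c': "c \<noteq> 0" "poly ?p c \<noteq> 0" by auto
  have "fps_X ^ r dvd fps_subst2 z (fps_X, fps_X * fps_const c)"
  proof (rule arc_dominatedD[OF dom])
    fix f assume "f \<in> I"
    then have "\<forall>n<r. blowup f $ n = 0" using I mem_mpow_iff_blowup by blast
    then show "fps_X ^ r dvd fps_subst2 f (fps_X, fps_X * fps_const c)"
      by (simp add: fps_X_power_dvd_iff_nth subst_line)
  qed (use c' in auto)
  then show False using d c' by (simp add: fps_X_power_dvd_iff_nth subst_line)
qed

text \<open>The extended ideal divided by the r-th power of the exceptional divisor, written as a
  colon ideal. For \<open>I \<subseteq> mpow r\<close> all its generators are divisible by
  x^r.\<close>

definition weak_transform :: "'a::comm_ring_1 fps fps set \<Rightarrow> nat \<Rightarrow> 'a \<Rightarrow> 'a fps fps set" where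
  "weak_transform I r c = {h. fps_X ^ r * h \<in> ideal_gen (chart c ` I)}"

lemma is_ideal_weak_transform: "is_ideal (weak_transform I r c)"
  using is_ideal_ideal_gen[of "chart c ` I"]
  by (auto simp: is_ideal_iff weak_transform_def distrib_left mult.left_commute[of "fps_X ^ r"])

lemma chart_factor:
  assumes "f \<in> mpow r"
  obtains h where "chart c f = fps_X ^ r * h" "h $ 0 = recenter c (blowup f $ r)"
proof
  show "chart c f = fps_X ^ r * fps_shift r (chart c f)"
    using assms by (intro fps_ext)
      (auto simp: fps_X_power_mult_nth chart_def mem_mpow_iff_blowup recenter.hom_zero)
qed (simp add: chart_def)

lemma weak_transform_witness:
  assumes "f \<in> I" "I \<subseteq> mpow r"
  obtains h where "h \<in> weak_transform I r c" "chart c f = fps_X ^ r * h" "h $ 0 = recenter c (blowup f $ r)"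
proof -
  obtain h where h: "chart c f = fps_X ^ r * h" "h $ 0 = recenter c (blowup f $ r)"
    using chart_factor[of f r c] assms by blast
  have "h \<in> weak_transform I r c" unfolding weak_transform_def using h(1) assms(1)
    by (auto intro: ideal_gen_base simp flip: h(1))
  then show ?thesis using that h by blast
qed

text \<open>An arc (u, v) of the chart lies over (u, u (v + c)), where all orders are larger by r
  ord u than those of the transforms; this shift is the same for \<open>I\<close> and for z.\<close>

lemma arc_dominated_weak_transform:
  assumes dom: "arc_dominated I z" and I: "I \<subseteq> mpow r" and z': "chart c z = fps_X ^ r * z'"
  shows "arc_dominated (weak_transform I r c) z'"
  unfolding arc_dominated_def
proof (intro allI impI)
  fix u v :: "'a fps" and d
  assume *: "u \<noteq> 0" "v \<noteq> 0" "u $ 0 = 0" "v $ 0 = 0"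
    "\<forall>h\<in>weak_transform I r c. fps_X ^ d dvd fps_subst2 h (u, v)"
  let ?w = "u * (v + fps_const c)"
  let ?e = "subdegree (u ^ r)"
  interpret a: arc "(u, v)" using * by unfold_locales auto
  have X: "fps_subst2 (fps_X ^ r * h) (u, v) = u ^ r * fps_subst2 h (u, v)" for h
    using a.subst_var_x by (simp add: a.subst.hom_mult a.subst.hom_power var_x_def)
  have chart: "fps_subst2 f (u, ?w) = fps_subst2 (chart c f) (u, v)" for f
    using subst_chart[of "(u, v)" c f] * by simp
  have e: "fps_X ^ ?e dvd u ^ r" using *(1) by (simp add: fps_dvd_iff)
  \<comment> \<open>The arc below must again have nonzero components: this factor is a unit for c
    \<noteq> 0 and equals v for c = 0.\<close>
  have "v + fps_const c \<noteq> 0"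
  proof
    assume "v + fps_const c = 0"
    then have "(v + fps_const c) $ 0 = 0" by simp
    then have "c = 0" using *(4) by simp
    then show False using \<open>v + fps_const c = 0\<close> *(2) by simp
  qed
  then have w: "?w \<noteq> 0" "?w $ 0 = 0" using * by auto
  have "fps_X ^ (?e + d) dvd fps_subst2 z (u, ?w)"
  proof (rule arc_dominatedD[OF dom *(1) w(1) *(3) w(2)])
    fix f assume f: "f \<in> I"
    obtain h where h: "h \<in> weak_transform I r c" "chart c f = fps_X ^ r * h"
      using weak_transform_witness[OF f I] by blast
    show "fps_X ^ (?e + d) dvd fps_subst2 f (u, ?w)"
      unfolding chart h X power_add using e *(5) h(1) by (intro mult_dvd_mono) auto
  qed
  then have dvd: "fps_X ^ (?e + d) dvd u ^ r * fps_subst2 z' (u, v)"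
    unfolding chart z' X .
  show "fps_X ^ d dvd fps_subst2 z' (u, v)"
  proof (cases "fps_subst2 z' (u, v) = 0")
    case False
    then have "?e + d \<le> subdegree (u ^ r * fps_subst2 z' (u, v))"
      using dvd *(1) by (subst (asm) fps_dvd_iff) auto
    then have "d \<le> subdegree (fps_subst2 z' (u, v))" using False *(1) by simp
    then show ?thesis using False by (simp add: fps_dvd_iff)
  qed simp
qed

section \<open>Order and primariness of weak transforms\<close>

lemma order_exists_le:
  assumes "f \<in> W" "f \<notin> mpow (Suc l)"
  obtains r where "r \<le> l" "W \<subseteq> mpow r" "\<not> W \<subseteq> mpow (Suc r)"
proof -
  let ?P = "\<lambda>n. \<not> W \<subseteq> mpow (Suc n)"
  have l: "?P l" using assms by blast
  have "W \<subseteq> mpow (LEAST n. ?P n)"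
  proof (cases "LEAST n. ?P n")
    case (Suc m)
    then show ?thesis using not_less_Least[of m ?P] by auto
  qed (simp add: mpow_0)
  then show ?thesis using that[of "LEAST n. ?P n"] LeastI[of ?P, OF l] Least_le[of ?P, OF l] by blast
qed

text \<open>The expansion of F at c has the same degree as F. Applied to the initial form of a
  series of order r, this bounds the order of the weak transform by r.\<close>

lemma recenter_nth_nonzero:
  fixes F :: "'a::idom poly"
  assumes "F \<noteq> 0" "degree F \<le> r"
  shows "\<exists>l\<le>r. recenter c F $ l \<noteq> 0"
proof -
  let ?q = "pcompose F [:c, 1:]"
  have "?q \<noteq> 0" using assms(1) pcompose_recenter_inverse(2)[of F c] by auto
  moreover have "degree ?q = degree F" by (simp add: degree_pcompose)
  ultimately show ?thesis using assms(2)
    by (metis fps_of_poly_nth leading_coeff_neq_0 recenter_def)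
qed

lemma degree_blowup_le: "degree (blowup f $ r) \<le> r"
  by (rule degree_le) (simp add: coeff_blowup)

text \<open>Modulo x the series h is h(0, y), a unit times a power of y. As h and x^e lie in
  \<open>W\<close>, so does the power 1 + e of h(0, y), hence a power of y.\<close>

lemma primary_if_regular:
  fixes W :: "'a::field fps fps set"
  assumes W: "is_ideal W" and h: "h \<in> W" "h $ 0 \<noteq> 0" and x: "var_x ^ e \<in> W"
  shows "\<exists>K. mpow K \<subseteq> W"
proof -
  let ?g = "h $ 0" let ?l = "subdegree ?g" let ?u = "fps_shift ?l ?g"
  have "h = fps_const ?g + var_x * fps_shift 1 h" by (intro fps_ext) (auto simp: var_x_def)
  then have g: "fps_const ?g = h + (- fps_shift 1 h * var_x)" by (simp add: algebra_simps)
  have "(- fps_shift 1 h * var_x) ^ e \<in> W"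
    unfolding power_mult_distrib by (rule ideal_multL[OF W x])
  moreover have "h ^ 1 \<in> W" using h by simp
  ultimately have "fps_const ?g ^ (1 + e) \<in> W"
    unfolding g by (intro ideal_add_power_mem W)
  then have "fps_const (inverse ?u ^ (1 + e)) * fps_const ?g ^ (1 + e) \<in> W" by (rule ideal_multL[OF W])
  moreover have "inverse ?u * ?u = 1" using h(2) by (intro inverse_mult_eq_1) simp
  moreover have "inverse ?u * ?g = (inverse ?u * ?u) * fps_X ^ ?l"
    unfolding mult.assoc by (rule arg_cong[OF subdegree_decompose])
  ultimately have u: "fps_const (inverse ?u ^ (1 + e)) * fps_const ?g ^ (1 + e) \<in> W"
    and inv: "inverse ?u * ?g = fps_X ^ ?l" by (simp_all only: mult_1)
  have "fps_const (inverse ?u ^ (1 + e)) * fps_const ?g ^ (1 + e) = var_y ^ (?l * (1 + e))"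
    by (simp only: fps_const_power fps_const_mult power_mult_distrib[symmetric] inv var_y_def power_mult)
  with u have "var_y ^ (?l * (1 + e)) \<in> W" by (simp only:)
  then show ?thesis using mpow_subset_if_pure_powers[OF W x] by blast
qed

lemma var_x_power_mem_weak_transform:
  assumes "var_x ^ K \<in> I" "r \<le> K" shows "var_x ^ (K - r) \<in> weak_transform I r c"
proof -
  have "fps_X ^ r * var_x ^ (K - r) = chart c (var_x ^ K)"
    unfolding chart.hom_power chart_var_x using assms(2) by (simp add: var_x_def flip: power_add)
  then show ?thesis unfolding weak_transform_def using assms(1) by (auto intro: ideal_gen_base)
qed

lemma var_power_mem_mpow_iff:
  "(var_x ^ K :: 'a::comm_ring_1 fps fps) \<in> mpow r \<longleftrightarrow> r \<le> K"
  "(var_y ^ K :: 'a::comm_ring_1 fps fps) \<in> mpow r \<longleftrightarrow> r \<le> K"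
proof -
  show "(var_x ^ K :: 'a fps fps) \<in> mpow r \<longleftrightarrow> r \<le> K"
    by (auto simp: mem_mpow_iff_blowup blowup.hom_power blowup_var_x fps_X_power_iff not_le)
  then show "(var_y ^ K :: 'a fps fps) \<in> mpow r \<longleftrightarrow> r \<le> K"
    using swap_mem_mpow[of "var_x ^ K :: 'a fps fps" r] by (simp add: swap.hom_power swap_var_x)
qed

text \<open>If the order does not drop at a point of the exceptional line, then the weak transform
  is regular in the second coordinate at that point.\<close>

lemma weak_transform_props:
  fixes I :: "'a::field fps fps set"
  assumes I: "I \<subseteq> mpow r" "\<not> I \<subseteq> mpow (Suc r)" and x: "var_x ^ e \<in> weak_transform I r c"
  obtains K r' where "mpow K \<subseteq> weak_transform I r c" "r' \<le> r" "weak_transform I r c \<subseteq> mpow r'"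
    "\<not> weak_transform I r c \<subseteq> mpow (Suc r')" "r' = r \<Longrightarrow> \<exists>h\<in>weak_transform I r c. h $ 0 $ r \<noteq> 0"
proof -
  let ?W = "weak_transform I r c"
  obtain f where f: "f \<in> I" "f \<notin> mpow (Suc r)" using I(2) by blast
  then have "f \<in> mpow r" using I(1) by blast
  then have F: "blowup f $ r \<noteq> 0" using f(2) by (auto simp: mem_mpow_iff_blowup less_Suc_eq)
  obtain h where h: "h \<in> ?W" "h $ 0 = recenter c (blowup f $ r)"
    using weak_transform_witness[OF f(1) I(1)] by blast
  obtain l where l: "l \<le> r" "h $ 0 $ l \<noteq> 0"
    using recenter_nth_nonzero[OF F degree_blowup_le] h(2) by metis
  obtain K where K: "mpow K \<subseteq> ?W"
    using primary_if_regular[OF is_ideal_weak_transform h(1) _ x] l(2) by (metis fps_zero_nth)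
  have "h \<notin> mpow (Suc l)" using l(2) mpowD[of h "Suc l" 0 l] by auto
  with h(1) obtain r' where r': "r' \<le> l" "?W \<subseteq> mpow r'" "\<not> ?W \<subseteq> mpow (Suc r')"
    by (rule order_exists_le)
  show ?thesis
  proof (rule that[OF K _ r'(2,3)])
    show "r' \<le> r" using r'(1) l(1) by simp
    \<comment> \<open>Since r' \<le> l \<le> r, an unchanged order forces l = r.\<close>
    show "\<exists>h\<in>?W. h $ 0 $ r \<noteq> 0" if "r' = r"
      using r'(1) l h(1) that by (intro bexI[of _ h]) auto
  qed
qed

text \<open>Domination forces z to have order at least r, so its image in each chart is x^r z'. The
  hypotheses apply to z', and multiplying by x^r gives integrality over the extended ideals, from
  which it descends.\<close>

lemma criterion_step:
  fixes z :: "'a::alg_closed_field fps fps"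
  assumes I: "is_ideal I" "mpow K \<subseteq> I" "I \<subseteq> mpow r" "\<not> I \<subseteq> mpow (Suc r)"
    and dom: "arc_dominated I z"
    and 1: "\<And>c z'. arc_dominated (weak_transform I r c) z' \<Longrightarrow>
      z' \<in> ideal_integral_closure (weak_transform I r c)"
    and 2: "\<And>c z'. arc_dominated (weak_transform (swap_vars ` I) r c) z' \<Longrightarrow>
      z' \<in> ideal_integral_closure (weak_transform (swap_vars ` I) r c)"
  shows "z \<in> ideal_integral_closure I"
proof -
  have *: "chart c z \<in> ideal_integral_closure (ideal_gen (chart c ` I))"
    if dom: "arc_dominated I z" and I: "I \<subseteq> mpow r" and z: "z \<in> mpow r"
      and IH: "\<And>z'. arc_dominated (weak_transform I r c) z' \<Longrightarrow>
        z' \<in> ideal_integral_closure (weak_transform I r c)" for z I c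
  proof -
    obtain z' where z': "chart c z = fps_X ^ r * z'" using chart_factor[OF z] by blast
    show ?thesis unfolding z'
      by (rule integral_closure_scaled[OF _ IH[OF arc_dominated_weak_transform[OF dom I z']]])
        (simp add: weak_transform_def)
  qed
  have z: "z \<in> mpow r" by (rule mem_mpow_if_arc_dominated[OF dom I(3)])
  show ?thesis
  proof (rule integral_closure_descent[OF I z])
    show "chart c z \<in> ideal_integral_closure (ideal_gen (chart c ` I))" for c
      by (rule *[OF dom I(3) z 1])
    show "chart c (swap_vars z) \<in> ideal_integral_closure (ideal_gen (chart c ` swap_vars ` I))" for c
      by (rule *[OF arc_dominated_swap[OF dom] _ _ 2]) (use I(3) z in \<open>auto simp: swap_mem_mpow\<close>)
  qed
qed

lemma integral_closure_if_unit_mem: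
  fixes I :: "'a::field fps fps set"
  assumes I: "is_ideal I" "\<not> I \<subseteq> mpow 1"
  shows "z \<in> ideal_integral_closure I"
proof -
  obtain f where f: "f \<in> I" "f $ 0 $ 0 \<noteq> 0" using I(2) by (auto simp: mpow_def)
  have "f $ 0 * inverse (f $ 0) = 1" using f(2) by (rule inverse_mult_eq_1')
  then have "f * fps_right_inverse f (inverse (f $ 0)) = 1" by (rule fps_right_inverse)
  then have "1 \<in> I" using ideal_multR[OF I(1) f(1)] by metis
  then have "z ^ 1 \<in> dep I z 1"
    using ideal_power_subset_dep[of 1 I z] ideal_power_oneI[of z I] ideal_multL[OF I(1), of 1 z] by auto
  then show ?thesis unfolding integral_closure_iff_dep by blast
qed

text \<open>While the order stays \<open>r\<close>, the exponent of the power of \<open>x\<close> in the ideal drops by \<open>r\<close>.\<close>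

lemma criterion_regular:
  fixes z :: "'a::alg_closed_field fps fps"
  assumes r: "r \<ge> 1"
    and IH: "\<And>r' I K (z :: 'a fps fps). r' < r \<Longrightarrow> is_ideal I \<Longrightarrow> mpow K \<subseteq> I \<Longrightarrow> I \<subseteq> mpow r' \<Longrightarrow>
      \<not> I \<subseteq> mpow (Suc r') \<Longrightarrow> arc_dominated I z \<Longrightarrow> z \<in> ideal_integral_closure I"
    and I: "is_ideal I" "mpow K \<subseteq> I" "I \<subseteq> mpow r" "f \<in> I" "f $ 0 $ r \<noteq> 0" "var_x ^ M \<in> I"
    and dom: "arc_dominated I z"
  shows "z \<in> ideal_integral_closure I"
  using I dom
proof (induction M arbitrary: I K f z rule: less_induct)
  case (less M)
  note I = less.prems(1-6) and dom = less.prems(7)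
  have nI: "\<not> I \<subseteq> mpow (Suc r)" using I(4,5) unfolding mpow_def by auto
  have rM: "r \<le> M" using I(3,6) var_power_mem_mpow_iff(1)[of M r] by blast
  have main: "z' \<in> ideal_integral_closure (weak_transform I' r c)"
    if dom': "arc_dominated (weak_transform I' r c) z'" and I': "I' \<subseteq> mpow r" "\<not> I' \<subseteq> mpow (Suc r)"
      and x: "var_x ^ (M - r) \<in> weak_transform I' r c" for I' :: "'a fps fps set" and c z'
  proof -
    let ?W = "weak_transform I' r c"
    obtain K' r' where W: "mpow K' \<subseteq> ?W" "r' \<le> r" "?W \<subseteq> mpow r'" "\<not> ?W \<subseteq> mpow (Suc r')"
      "r' = r \<Longrightarrow> \<exists>h\<in>?W. h $ 0 $ r \<noteq> 0" using weak_transform_props[OF I' x] by blast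
    show ?thesis
    proof (cases "r' = r")
      case True
      then obtain h where "h \<in> ?W" "h $ 0 $ r \<noteq> 0" using W(5) by blast
      then show ?thesis
        using less.IH[OF _ is_ideal_weak_transform W(1) _ _ _ x dom', of h] W(3) True r rM by simp
    next
      case False
      then show ?thesis using IH[OF _ is_ideal_weak_transform W(1,3,4) dom'] W(2) by simp
    qed
  qed
  let ?S = "swap_vars ` I"
  have S: "?S \<subseteq> mpow r" "\<not> ?S \<subseteq> mpow (Suc r)"
    using I(3) nI by (auto simp: swap_mem_mpow)
  show ?case
  proof (rule criterion_step[OF I(1,2,3) nI dom])
    fix c z' assume "arc_dominated (weak_transform I r c) z'"
    then show "z' \<in> ideal_integral_closure (weak_transform I r c)"
      by (rule main[OF _ I(3) nI var_x_power_mem_weak_transform[OF I(6) rM]])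
  next
    fix c z' assume dom': "arc_dominated (weak_transform ?S r c) z'"
    let ?W = "weak_transform ?S r c"
    show "z' \<in> ideal_integral_closure ?W"
    proof (cases "c = 0")
      \<comment> \<open>In the swapped chart c = 0 is the direction x = 0. The initial form of f
        contains y^r, so its transform is a unit at this point.\<close>
      case True
      have "swap_vars f \<in> ?S" using I(4) by simp
      then obtain h where h: "h \<in> ?W" "h $ 0 = recenter c (blowup (swap_vars f) $ r)"
        using weak_transform_witness[OF _ S(1)] by blast
      have "h $ 0 $ 0 \<noteq> 0" using I(5) True by (simp add: h(2) recenter_def coeff_blowup pcompose_idR)
      then have "\<not> ?W \<subseteq> mpow 1" using h(1) by (auto simp: mpow_def)
      then show ?thesis by (rule integral_closure_if_unit_mem[OF is_ideal_weak_transform])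
    next
      case False
      \<comment> \<open>At the other points of the swapped chart x^M is mapped to x^M (y + c)^M with
        a unit as second factor, so the exponent drops as in the first chart.\<close>
      let ?u = "(var_y + fps_cc c) ^ M" and ?g = "(fps_X + fps_const c) ^ M"
      have "inverse ?g * ?g = 1" using False by (intro inverse_mult_eq_1) (simp add: fps_power_zeroth)
      moreover have "?u = fps_const ?g"
        by (simp only: var_y_def fps_cc_def fps_const_power fps_const_add)
      ultimately have inv: "fps_const (inverse ?g) * ?u = 1" by simp
      have "chart c (swap_vars (var_x ^ M)) \<in> ideal_gen (chart c ` ?S)"
        using I(6) by (intro ideal_gen_base) auto
      then have "var_x ^ M * ?u \<in> ideal_gen (chart c ` ?S)"
        by (simp add: swap.hom_power swap_var_x chart.hom_power chart_var_y power_mult_distrib)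
      then have "fps_const (inverse ?g) * (var_x ^ M * ?u) \<in> ideal_gen (chart c ` ?S)"
        by (rule ideal_multL[OF is_ideal_ideal_gen])
      moreover have "fps_const (inverse ?g) * (var_x ^ M * ?u) = var_x ^ M"
        using inv by (metis mult.left_commute mult.right_neutral)
      ultimately have "var_x ^ M \<in> ideal_gen (chart c ` ?S)" by (simp only:)
      moreover have "var_x ^ M = fps_X ^ r * (var_x ^ (M - r) :: 'a fps fps)"
        using rM by (simp add: var_x_def flip: power_add)
      ultimately have "var_x ^ (M - r) \<in> ?W" by (simp only: weak_transform_def mem_Collect_eq)
      then show ?thesis by (rule main[OF dom' S])
    qed
  qed
qed

text \<open>Outer induction on the order r. The coordinates may be badly placed at first, but at
  each point of the first blow-up either the order has dropped or the ideal has become regular in y,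
  which is where \<open>criterion_regular\<close> takes over.\<close>

theorem integral_closure_if_arc_dominated:
  fixes z :: "'a::alg_closed_field fps fps"
  assumes "is_ideal I" "mpow K \<subseteq> I" "arc_dominated I z"
  shows "z \<in> ideal_integral_closure I"
proof -
  have "z \<in> ideal_integral_closure I"
    if "is_ideal I" "mpow K \<subseteq> I" "I \<subseteq> mpow r" "\<not> I \<subseteq> mpow (Suc r)" "arc_dominated I z"
    for r K and I :: "'a fps fps set" and z :: "'a fps fps"
    using that
  proof (induction r arbitrary: I K z rule: less_induct)
    case (less r)
    note I = less.prems(1-4) and dom = less.prems(5)
    show ?case
    proof (cases "r = 0")
      case True
      then show ?thesis using integral_closure_if_unit_mem[OF I(1)] I(4) by simp
    next
      case False
      have main: "z' \<in> ideal_integral_closure (weak_transform I' r c)"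
        if dom': "arc_dominated (weak_transform I' r c) z'"
          and I': "mpow K \<subseteq> I'" "I' \<subseteq> mpow r" "\<not> I' \<subseteq> mpow (Suc r)" for I' :: "'a fps fps set" and c z'
      proof -
        let ?W = "weak_transform I' r c"
        have "var_x ^ K \<in> I'" using I'(1) var_power_mem_mpow_iff(1) by blast
        moreover from this have "r \<le> K" using I'(2) var_power_mem_mpow_iff(1) by blast
        ultimately have "var_x ^ (K - r) \<in> ?W" by (rule var_x_power_mem_weak_transform)
        then obtain K' r' where W: "mpow K' \<subseteq> ?W" "r' \<le> r" "?W \<subseteq> mpow r'" "\<not> ?W \<subseteq> mpow (Suc r')"
          "r' = r \<Longrightarrow> \<exists>h\<in>?W. h $ 0 $ r \<noteq> 0" using weak_transform_props[OF I'(2,3)] by blast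
        have x: "var_x ^ K' \<in> ?W" using W(1) var_power_mem_mpow_iff(1) by blast
        show ?thesis
        proof (cases "r' = r")
          case True
          then obtain h where h: "h \<in> ?W" "h $ 0 $ r \<noteq> 0" using W(5) by blast
          show ?thesis
          proof (rule criterion_regular[OF _ less.IH is_ideal_weak_transform W(1) _ h x dom'])
            show "1 \<le> r" using \<open>r \<noteq> 0\<close> by simp
            show "?W \<subseteq> mpow r" using W(3) True by simp
          qed
        next
          case False
          then show ?thesis using less.IH[OF _ is_ideal_weak_transform W(1,3,4) dom'] W(2) by simp
        qed
      qed
      show ?thesis
      proof (rule criterion_step[OF I dom])
        show "z' \<in> ideal_integral_closure (weak_transform I r c)"
          if "arc_dominated (weak_transform I r c) z'" for c z' using main[OF that I(2-4)] .
        show "z' \<in> ideal_integral_closure (weak_transform (swap_vars ` I) r c)"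
          if "arc_dominated (weak_transform (swap_vars ` I) r c) z'" for c z'
        proof (rule main[OF that])
          show "mpow K \<subseteq> swap_vars ` I" using I(2) by (auto simp: swap_image_eq swap_mem_mpow)
        qed (use I(3,4) in \<open>auto simp: swap_mem_mpow\<close>)
      qed
    qed
  qed
  moreover obtain r where "I \<subseteq> mpow r" "\<not> I \<subseteq> mpow (Suc r)"
  proof -
    have "var_x ^ K \<in> I" using assms(2) var_power_mem_mpow_iff(1) by blast
    moreover have "var_x ^ K \<notin> (mpow (Suc K) :: 'a fps fps set)" by (simp add: var_power_mem_mpow_iff)
    ultimately show ?thesis using order_exists_le that by metis
  qed
  ultimately show ?thesis using assms by blast
qed

subsection \<open>Primary ideals from initial forms\<close>

lemma mpow_limit:
  assumes "\<And>k. u k \<in> mpow k"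
  obtains U where "\<And>n. U - (\<Sum>k<n. u k) \<in> mpow n"
proof
  fix n
  let ?U = "Abs_fps (\<lambda>i. Abs_fps (\<lambda>j. \<Sum>k\<le>i+j. u k $ i $ j))"
  have "(\<Sum>k\<le>i+j. u k $ i $ j) = (\<Sum>k<n. u k $ i $ j)" if "i + j < n" for i j
    by (rule sum.mono_neutral_left) (use that mpowD[OF assms] in auto)
  then show "?U - (\<Sum>k<n. u k) \<in> mpow n"
    by (auto simp: mpow_def fps_sum_nth)
qed

lemma eq_0_if_mem_mpow: "(\<And>n. f \<in> mpow n) \<Longrightarrow> f = 0"
  using mpowD[of f] by (intro fps_ext) (metis fps_zero_nth lessI)

definition add_sets :: "'a::comm_ring_1 set \<Rightarrow> 'a set \<Rightarrow> 'a set" where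
  "add_sets I J = {u + v | u v. u \<in> I \<and> v \<in> J}"

lemma is_ideal_add_sets:
  assumes I: "is_ideal I" and J: "is_ideal J" shows "is_ideal (add_sets I J)"
  unfolding is_ideal_iff
proof (intro conjI ballI allI)
  show "0 \<in> add_sets I J" unfolding add_sets_def
    using ideal_zeroI[OF I] ideal_zeroI[OF J] by (intro CollectI exI[of _ 0]) simp
next
  fix a b assume "a \<in> add_sets I J" "b \<in> add_sets I J"
  then obtain u v u' v' where "a = u + v" "b = u' + v'" "u \<in> I" "u' \<in> I" "v \<in> J" "v' \<in> J"
    by (auto simp: add_sets_def)
  then show "a + b \<in> add_sets I J" unfolding add_sets_def
    by (intro CollectI exI[of _ "u + u'"] exI[of _ "v + v'"])
      (auto simp: algebra_simps intro: ideal_add[OF I] ideal_add[OF J])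
next
  fix r a assume "a \<in> add_sets I J"
  then obtain u v where "a = u + v" "u \<in> I" "v \<in> J" by (auto simp: add_sets_def)
  then show "r * a \<in> add_sets I J" unfolding add_sets_def
    by (intro CollectI exI[of _ "r * u"] exI[of _ "r * v"])
      (auto simp: algebra_simps intro: ideal_multL[OF I] ideal_multL[OF J])
qed

lemma add_setsI: "u \<in> I \<Longrightarrow> v \<in> J \<Longrightarrow> u + v \<in> add_sets I J"
  by (auto simp: add_sets_def)

text \<open>A monomial of degree s \<ge> A + B is divisible by x^A or y^B. The orders of the
  cofactors are recorded to make the approximation below converge.\<close>

lemma pure_power_decomposition:
  fixes h :: "'a::comm_ring_1 fps fps"
  assumes "h \<in> mpow s" "A + B \<le> s"
  shows "\<exists>u\<in>mpow (s - A). \<exists>v\<in>mpow (s - B). h = var_x ^ A * u + var_y ^ B * v"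
proof -
  define P :: "'a fps fps \<Rightarrow> bool" where
    "P h \<longleftrightarrow> (\<exists>u\<in>mpow (s - A). \<exists>v\<in>mpow (s - B). h = var_x ^ A * u + var_y ^ B * v)" for h
  have PI: "P h" if "h = var_x ^ A * u + var_y ^ B * v" "v \<in> mpow (s - B)" "u \<in> mpow (s - A)"
    for h u v using that unfolding P_def by blast
  have zero: "0 \<in> (mpow n :: 'a fps fps set)" for n by (rule ideal_zeroI[OF is_ideal_mpow])
  have P0: "P 0" by (rule PI[OF _ zero zero]) simp
  have Padd: "P (a + b)" if ab: "P a" "P b" for a b :: "'a fps fps"
  proof -
    obtain u v u' v' where *: "u \<in> mpow (s - A)" "v \<in> mpow (s - B)" "u' \<in> mpow (s - A)"
      "v' \<in> mpow (s - B)" "a = var_x ^ A * u + var_y ^ B * v" "b = var_x ^ A * u' + var_y ^ B * v'"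
      using ab unfolding P_def by blast
    have "a + b = var_x ^ A * (u + u') + var_y ^ B * (v + v')" by (simp add: * algebra_simps)
    then show ?thesis
      by (rule PI[OF _ ideal_add[OF is_ideal_mpow *(2,4)] ideal_add[OF is_ideal_mpow *(1,3)]])
  qed
  have Pmult: "P (r * a)" if a: "P a" for r a :: "'a fps fps"
  proof -
    obtain u v where *: "u \<in> mpow (s - A)" "v \<in> mpow (s - B)" "a = var_x ^ A * u + var_y ^ B * v"
      using a unfolding P_def by blast
    have "r * a = var_x ^ A * (r * u) + var_y ^ B * (r * v)" by (simp add: * algebra_simps)
    then show ?thesis
      by (rule PI[OF _ ideal_multL[OF is_ideal_mpow *(2)] ideal_multL[OF is_ideal_mpow *(1)]])
  qed
  have Q: "is_ideal {h. P h}"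
    unfolding is_ideal_iff mem_Collect_eq by (intro conjI ballI allI P0 Padd Pmult) simp_all
  have "P (var_x ^ i * var_y ^ (s - i))" if "i \<le> s" for i
  proof (cases "A \<le> i")
    case True
    then have "var_x ^ i = var_x ^ A * (var_x ^ (i - A) :: 'a fps fps)" by (simp flip: power_add)
    then have "var_x ^ i * var_y ^ (s - i) =
        var_x ^ A * (var_x ^ (i - A) * var_y ^ (s - i)) + var_y ^ B * (0 :: 'a fps fps)"
      by (simp add: mult.assoc)
    moreover have "var_x ^ (i - A) * var_y ^ (s - i) \<in> mpow (s - A)"
      using monom_mem_mpow[of "i - A" "s - i"] True that by simp
    ultimately show ?thesis by (rule PI[OF _ zero])
  next
    case False
    then have "var_y ^ (s - i) = var_y ^ B * (var_y ^ (s - i - B) :: 'a fps fps)"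
      using assms(2) by (simp flip: power_add)
    then have "var_x ^ i * var_y ^ (s - i) =
        var_x ^ A * 0 + var_y ^ B * (var_x ^ i * var_y ^ (s - i - B) :: 'a fps fps)"
      by (simp only: mult_zero_right add_0 mult.left_commute)
    moreover have "var_x ^ i * var_y ^ (s - i - B) \<in> mpow (s - B)"
      using monom_mem_mpow[of i "s - i - B"] False assms(2) by simp
    ultimately show ?thesis by (rule PI[OF _ _ zero])
  qed
  then have mono: "a * (var_x ^ i * var_y ^ (s - i)) \<in> {h. P h}" if "i \<le> s" for a i
    by (intro ideal_multL[OF Q, of "var_x ^ i * var_y ^ (s - i)"] CollectI) (use that in blast)
  obtain g where g: "h = (\<Sum>i\<le>s. g i * (var_x ^ i * var_y ^ (s - i)))"
    using mpow_subset_forms[of s 0] assms(1) by (auto simp: forms_def)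
  have "h \<in> {h. P h}" unfolding g by (rule ideal_sum[OF Q]) (rule mono, simp)
  then show ?thesis unfolding P_def by blast
qed

text \<open>Successive approximation: replacing x^A and y^B by f and g in a decomposition of the
  remainder raises its order. The corrections have growing order, so their sums converge.\<close>

lemma mpow_subset_if_initial_forms:
  fixes f g :: "'a::comm_ring_1 fps fps"
  assumes I: "is_ideal I" "f \<in> I" "g \<in> I"
    and f: "var_x ^ A - f \<in> mpow (Suc A)" and g: "var_y ^ B - g \<in> mpow (Suc B)"
  shows "mpow (A + B) \<subseteq> I"
proof
  let ?s = "A + B"
  fix h :: "'a fps fps" assume h: "h \<in> mpow ?s"
  have "\<exists>u\<in>mpow (s - A). \<exists>v\<in>mpow (s - B). h - (f * u + g * v) \<in> mpow (Suc s)"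
    if "h \<in> mpow s" "?s \<le> s" for h s
  proof -
    obtain u v where uv: "u \<in> mpow (s - A)" "v \<in> mpow (s - B)" "h = var_x ^ A * u + var_y ^ B * v"
      using pure_power_decomposition[OF \<open>h \<in> mpow s\<close> \<open>?s \<le> s\<close>] by blast
    have "h - (f * u + g * v) = (var_x ^ A - f) * u + (var_y ^ B - g) * v"
      by (simp add: uv(3) algebra_simps)
    moreover have "(var_x ^ A - f) * u \<in> mpow (Suc s)"
      using mult_mem_mpow[OF f uv(1)] \<open>?s \<le> s\<close> by simp
    moreover have "(var_y ^ B - g) * v \<in> mpow (Suc s)"
      using mult_mem_mpow[OF g uv(2)] \<open>?s \<le> s\<close> by simp
    ultimately have "h - (f * u + g * v) \<in> mpow (Suc s)"
      by (simp only:) (rule ideal_add[OF is_ideal_mpow])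
    then show ?thesis using uv(1,2) by blast
  qed
  then have "\<forall>k h. \<exists>u v. h \<in> mpow (?s + k) \<longrightarrow>
      u \<in> mpow (?s + k - A) \<and> v \<in> mpow (?s + k - B) \<and> h - (f * u + g * v) \<in> mpow (?s + Suc k)"
    by (metis add_Suc_right le_add1)
  then obtain U V where UV: "\<And>k h. h \<in> mpow (?s + k) \<Longrightarrow> U k h \<in> mpow (?s + k - A) \<and>
      V k h \<in> mpow (?s + k - B) \<and> h - (f * U k h + g * V k h) \<in> mpow (?s + Suc k)" by metis
  define H where "H = rec_nat h (\<lambda>k h. h - (f * U k h + g * V k h))"
  have H0: "H 0 = h" and HS: "H (Suc k) = H k - (f * U k (H k) + g * V k (H k))" for k
    by (simp_all add: H_def)
  have H: "H k \<in> mpow (?s + k)" for k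
    by (induction k) (use h UV in \<open>auto simp: H0 HS\<close>)
  have "U k (H k) \<in> mpow k" "V k (H k) \<in> mpow k" for k
    using UV[OF H, of k] mpow_antimono[of k "?s + k - A"] mpow_antimono[of k "?s + k - B"] by auto
  then obtain u v where u: "\<And>n. u - (\<Sum>k<n. U k (H k)) \<in> mpow n" and v: "\<And>n. v - (\<Sum>k<n. V k (H k)) \<in> mpow n"
    by (metis mpow_limit)
  have sum: "H n = h - f * (\<Sum>k<n. U k (H k)) - g * (\<Sum>k<n. V k (H k))" for n
    by (induction n) (simp_all add: H0 HS algebra_simps)
  have "h - (f * u + g * v) = 0"
  proof (rule eq_0_if_mem_mpow)
    fix n
    have "H n \<in> mpow n" using H[of n] mpow_antimono[of n "?s + n"] by auto
    then have "H n - f * (u - (\<Sum>k<n. U k (H k))) - g * (v - (\<Sum>k<n. V k (H k))) \<in> mpow n"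
      by (rule ideal_diff[OF is_ideal_mpow ideal_diff[OF is_ideal_mpow _ ideal_multL[OF is_ideal_mpow u]]
            ideal_multL[OF is_ideal_mpow v]])
    moreover have "H n - f * (u - (\<Sum>k<n. U k (H k))) - g * (v - (\<Sum>k<n. V k (H k))) = h - (f * u + g * v)"
      unfolding sum[of n] by (simp add: algebra_simps)
    ultimately show "h - (f * u + g * v) \<in> mpow n" by (simp only:)
  qed
  then have "h = f * u + g * v" by simp
  then show "h \<in> I" using I by (auto intro!: ideal_add ideal_multR)
qed

text \<open>Modulo \<open>\<aa>\<close> the coefficient b_j lies in (x, y)^((p + 1) j), so b_j z^(N
  - j) has order at least p N + j there, and j \<ge> 1. For z = x^p this gives an element of
  \<open>\<aa>\<close> with initial form x^(p N).\<close>

lemma initial_form_if_integral: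
  assumes a: "is_ideal \<aa>" and z: "z \<in> mpow p" "z \<in> ideal_integral_closure (add_sets \<aa> (mpow (Suc p)))"
  shows "\<exists>N. \<exists>f\<in>\<aa>. z ^ N - f \<in> mpow (Suc (p * N))"
proof -
  let ?I = "add_sets \<aa> (mpow (Suc p))"
  have id: "is_ideal (add_sets \<aa> (mpow n))" for n by (rule is_ideal_add_sets[OF a is_ideal_mpow])
  obtain N where N: "N \<ge> 1" "z ^ N \<in> dep ?I z N" using z(2) by (auto simp: integral_closure_iff_dep)
  have pow: "ideal_power ?I j \<subseteq> add_sets \<aa> (mpow (Suc p * j))" for j
  proof (rule ideal_power_subset[where Q = "\<lambda>j. add_sets \<aa> (mpow (Suc p * j))"])
    show "1 \<in> add_sets \<aa> (mpow (Suc p * 0))"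
      using add_setsI[OF ideal_zeroI[OF a], of 1 "mpow 0"] by (simp add: mpow_0)
    fix n x y assume "x \<in> ?I" "y \<in> add_sets \<aa> (mpow (Suc p * n))"
    then obtain u v u' v' where *: "x = u + v" "y = u' + v'" "u \<in> \<aa>" "u' \<in> \<aa>" "v \<in> mpow (Suc p)"
      "v' \<in> mpow (Suc p * n)" by (auto simp: add_sets_def)
    have "x * y = (u * y + v * u') + v * v'" by (simp add: * algebra_simps)
    moreover have "u * y + v * u' \<in> \<aa>"
      using * by (intro ideal_add[OF a] ideal_multL[OF a] ideal_multR[OF a])
    moreover have "v * v' \<in> mpow (Suc p * Suc n)" using mult_mem_mpow[OF *(5,6)] by simp
    ultimately show "x * y \<in> add_sets \<aa> (mpow (Suc p * Suc n))" by (metis add_setsI)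
  qed (rule id)
  have "dep ?I z N \<subseteq> add_sets \<aa> (mpow (Suc (p * N)))"
  proof (rule dep_least[OF id])
    fix b j assume j: "b \<in> ideal_power ?I j" "1 \<le> j" "j \<le> N"
    then obtain u v where uv: "b = u + v" "u \<in> \<aa>" "v \<in> mpow (Suc p * j)"
      using pow[of j] by (auto simp: add_sets_def)
    have "v * z ^ (N - j) \<in> mpow (Suc p * j + p * (N - j))"
      by (intro mult_mem_mpow power_mem_mpow uv z)
    moreover have "Suc p * j + p * (N - j) = p * N + j"
      using j by (simp add: algebra_simps flip: distrib_left)
    ultimately have "v * z ^ (N - j) \<in> mpow (p * N + j)" by (simp only:)
    then have "v * z ^ (N - j) \<in> mpow (Suc (p * N))"
      using mpow_antimono[of "Suc (p * N)" "p * N + j"] j by auto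
    then show "b * z ^ (N - j) \<in> add_sets \<aa> (mpow (Suc (p * N)))"
      unfolding uv(1) distrib_right by (intro add_setsI ideal_multR[OF a] uv)
  qed
  then obtain f w where "z ^ N = f + w" "f \<in> \<aa>" "w \<in> mpow (Suc (p * N))"
    using N(2) by (auto simp: add_sets_def)
  then show ?thesis by (intro exI[of _ N] bexI[of _ f]) auto
qed

subsection \<open>Orders along arcs\<close>

lemma fps_X_power_dvd_iff_subdegree: "fps_X ^ d dvd g \<longleftrightarrow> g = 0 \<or> d \<le> subdegree g"
  for g :: "'a::field fps"
  by (cases "g = 0") (auto simp: fps_dvd_iff)

text \<open>If z had order e < D, every term b_j z^(N - j) of an integral equation would have order
  at least j D + e (N - j) > e N, the order of z^N.\<close>

lemma integral_closure_dvd: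
  fixes h :: "'b::comm_ring_1 \<Rightarrow> 'a::field fps"
  assumes "comm_ring_hom h" and I: "\<And>b. b \<in> I \<Longrightarrow> fps_X ^ D dvd h b"
    and z: "z \<in> ideal_integral_closure I"
  shows "fps_X ^ D dvd h z"
proof (rule ccontr)
  assume *: "\<not> fps_X ^ D dvd h z"
  interpret comm_ring_hom h by fact
  let ?e = "subdegree (h z)"
  from * have nz: "h z \<noteq> 0" and e: "?e < D" by (auto simp: fps_X_power_dvd_iff_subdegree)
  obtain N where N: "N \<ge> 1" "z ^ N \<in> dep I z N" using z by (auto simp: integral_closure_iff_dep)
  have "dep I z N \<subseteq> {w. fps_X ^ (Suc (?e * N)) dvd h w}"
  proof (rule dep_least)
    show "is_ideal {w. fps_X ^ (Suc (?e * N)) dvd h w}"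
      by (auto simp: is_ideal_iff hom_zero hom_add hom_mult)
    fix b j assume j: "b \<in> ideal_power I j" "1 \<le> j" "j \<le> N"
    have "(fps_X ^ D) ^ j dvd h b"
      using dvd_ideal_power[OF assms(1) I j(1)] by blast
    moreover have "(fps_X ^ ?e) ^ (N - j) dvd h z ^ (N - j)"
      by (intro dvd_power_same) (simp add: fps_X_power_dvd_iff_subdegree)
    ultimately have "fps_X ^ (D * j + ?e * (N - j)) dvd h (b * z ^ (N - j))"
      unfolding power_add power_mult hom_mult hom_power by (rule mult_dvd_mono)
    moreover have "Suc (?e * N) \<le> D * j + ?e * (N - j)"
    proof -
      have "?e * N = ?e * j + ?e * (N - j)" using j by (simp flip: distrib_left)
      moreover have "?e * j < D * j" using e j by simp
      ultimately show ?thesis by linarith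
    qed
    ultimately show "b * z ^ (N - j) \<in> {w. fps_X ^ (Suc (?e * N)) dvd h w}"
      using le_imp_power_dvd dvd_trans by blast
  qed
  then have "fps_X ^ (Suc (?e * N)) dvd h z ^ N" using N(2) by (auto simp: hom_power)
  then show False using nz
    by (simp add: fps_X_power_dvd_iff_subdegree mult.commute del: power_Suc)
qed

lemma arcsE:
  fixes \<phi> :: "'a::field fps \<times> 'a fps"
  assumes "\<phi> \<in> arcs"
  obtains n where "pair_ord \<phi> = enat n" "n > 0" "fst \<phi> $ 0 = 0" "snd \<phi> $ 0 = 0"
    "fps_X ^ n dvd fst \<phi>" "fps_X ^ n dvd snd \<phi>"
    "(fst \<phi> \<noteq> 0 \<and> subdegree (fst \<phi>) = n) \<or> (snd \<phi> \<noteq> 0 \<and> subdegree (snd \<phi>) = n)"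
proof -
  obtain u v where \<phi>: "\<phi> = (u, v)" by (cases \<phi>)
  have *: "u \<noteq> 0 \<or> v \<noteq> 0" "u $ 0 = 0" "v $ 0 = 0" using assms by (auto simp: arcs_def \<phi>)
  have pos: "subdegree w > 0" if "w \<noteq> 0" "w $ 0 = 0" for w :: "'a fps"
    using that by (metis gr0I nth_subdegree_nonzero)
  show ?thesis
  proof (cases "u = 0")
    case True
    then show ?thesis using that[of "subdegree v"] * pos[of v]
      by (simp add: pair_ord_def fps_ord_def \<phi> fps_X_power_dvd_iff_subdegree)
  next
    case u: False
    show ?thesis
    proof (cases "v = 0")
      case True
      then show ?thesis using that[of "subdegree u"] * pos[of u] u
        by (simp add: pair_ord_def fps_ord_def \<phi> fps_X_power_dvd_iff_subdegree)
    next
      case False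
      then show ?thesis using that[of "min (subdegree u) (subdegree v)"] * pos[of u] pos[of v] u
        by (auto simp: pair_ord_def fps_ord_def \<phi> fps_X_power_dvd_iff_subdegree min_def)
    qed
  qed
qed

section \<open>The exponent compared with integral closures\<close>

lemma ennreal_of_nat_divide_le_iff:
  assumes "n > 0" "q > 0"
  shows "(of_nat m / of_nat n :: ennreal) \<le> of_nat p / of_nat q \<longleftrightarrow> q * m \<le> p * n"
proof -
  have "(of_nat m / of_nat n :: ennreal) = ennreal (real m / real n)"
    "(of_nat p / of_nat q :: ennreal) = ennreal (real p / real q)"
    using assms by (simp_all add: ennreal_of_nat_eq_real_of_nat divide_ennreal)
  moreover have "real m / real n \<le> real p / real q \<longleftrightarrow> q * m \<le> p * n"
  proof -
    have "real m / real n \<le> real p / real q \<longleftrightarrow> real (q * m) \<le> real (p * n)"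
      using assms by (simp add: field_simps)
    then show ?thesis by (simp only: of_nat_le_iff)
  qed
  ultimately show ?thesis by simp
qed

lemma lojasiewicz_le_if_integral:
  fixes \<aa> :: "'k::field fps fps set"
  assumes pq: "0 < q"
    and sub: "ideal_power (ideal_gen {var_x, var_y}) p \<subseteq> ideal_integral_closure (ideal_power \<aa> q)"
  shows "lojasiewicz_exponent \<aa> \<le> of_nat p / of_nat q"
  unfolding lojasiewicz_exponent_def
proof (rule SUP_least)
  fix \<phi> :: "'k fps \<times> 'k fps" assume "\<phi> \<in> arcs"
  then obtain n where n: "pair_ord \<phi> = enat n" "n > 0" "fst \<phi> $ 0 = 0" "snd \<phi> $ 0 = 0"
    "(fst \<phi> \<noteq> 0 \<and> subdegree (fst \<phi>) = n) \<or> (snd \<phi> \<noteq> 0 \<and> subdegree (snd \<phi>) = n)"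
    by (elim arcsE)
  interpret arc \<phi> using n by unfold_locales auto
  \<comment> \<open>The least d with q d > p n. If all of \<open>\<aa>\<close> had order at least d
    along the arc, x^p and y^p would have order at least q d > p n, although one component has order
    exactly n.\<close>
  define d where "d = Suc (p * n div q)"
  have qd: "p * n < q * d" using pq unfolding d_def
    by (metis dividend_less_times_div mult_Suc_right add.commute)
  have "\<exists>f\<in>\<aa>. \<not> fps_X ^ d dvd fps_subst2 f \<phi>"
  proof (rule ccontr)
    assume "\<not> (\<exists>f\<in>\<aa>. \<not> fps_X ^ d dvd fps_subst2 f \<phi>)"
    then have "(fps_X ^ d) ^ q dvd fps_subst2 b \<phi>" if "b \<in> ideal_power \<aa> q" for b
      using dvd_ideal_power[OF subst.comm_ring_hom_axioms _ that] by blast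
    then have int: "fps_X ^ (q * d) dvd fps_subst2 z \<phi>" if "z \<in> ideal_integral_closure (ideal_power \<aa> q)" for z
      using integral_closure_dvd[OF subst.comm_ring_hom_axioms _ that, of "q * d"]
      by (simp add: power_mult mult.commute[of q])
    have "w ^ p \<in> ideal_integral_closure (ideal_power \<aa> q)" if "w \<in> {var_x, var_y}" for w
      using sub power_mem_ideal_power[OF ideal_gen_base[OF that]] by blast
    from int[OF this] have "fps_X ^ (q * d) dvd fps_subst2 w \<phi> ^ p" if "w \<in> {var_x, var_y}" for w
      using that unfolding subst.hom_power .
    from this[of var_x] this[of var_y]
    have "fps_X ^ (q * d) dvd fst \<phi> ^ p" "fps_X ^ (q * d) dvd snd \<phi> ^ p"
      by (simp_all add: subst_var_x subst_var_y)
    then show False using n(5) qd by (auto simp: fps_X_power_dvd_iff_subdegree)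
  qed
  then obtain f where f: "f \<in> \<aa>" "fps_subst2 f \<phi> \<noteq> 0" "subdegree (fps_subst2 f \<phi>) < d"
    by (auto simp: fps_X_power_dvd_iff_subdegree)
  then have "subdegree (fps_subst2 f \<phi>) \<le> p * n div q" by (simp add: d_def)
  then have "q * subdegree (fps_subst2 f \<phi>) \<le> p * n"
    using pq by (metis less_eq_div_iff_mult_less_eq mult.commute)
  then have "ennreal_of_enat (fps_ord (fps_subst2 f \<phi>)) / ennreal_of_enat (pair_ord \<phi>) \<le> of_nat p / of_nat q"
    using n(1,2) pq f(2) by (simp add: fps_ord_def ennreal_of_nat_divide_le_iff)
  then show "(INF f\<in>\<aa>. ennreal_of_enat (fps_ord (fps_subst2 f \<phi>)) / ennreal_of_enat (pair_ord \<phi>)) \<le> of_nat p / of_nat q"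
    by (rule INF_lower2[OF f(1)])
qed

lemma lojasiewicz_lessD:
  fixes \<aa> :: "'k::field fps fps set"
  assumes less: "lojasiewicz_exponent \<aa> < of_nat p / of_nat q" and q: "0 < q"
    and \<phi>: "\<phi> \<in> arcs" "pair_ord \<phi> = enat n" "n > 0"
  obtains f where "f \<in> \<aa>" "fps_subst2 f \<phi> \<noteq> 0" "q * subdegree (fps_subst2 f \<phi>) < p * n"
proof -
  have "(INF f\<in>\<aa>. ennreal_of_enat (fps_ord (fps_subst2 f \<phi>)) / ennreal_of_enat (pair_ord \<phi>)) < of_nat p / of_nat q"
    using less unfolding lojasiewicz_exponent_def by (rule le_less_trans[OF SUP_upper[OF \<phi>(1)]])
  then obtain f where f: "f \<in> \<aa>"
    "ennreal_of_enat (fps_ord (fps_subst2 f \<phi>)) / ennreal_of_enat (pair_ord \<phi>) < of_nat p / of_nat q"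
    by (auto simp: INF_less_iff)
  have nz: "fps_subst2 f \<phi> \<noteq> 0"
  proof
    assume "fps_subst2 f \<phi> = 0"
    then show False using f(2) \<phi>(2) by (simp add: fps_ord_def ennreal_top_divide)
  qed
  then have "(of_nat (subdegree (fps_subst2 f \<phi>)) / of_nat n :: ennreal) < of_nat p / of_nat q"
    using f(2) \<phi>(2) by (simp add: fps_ord_def)
  then have "q * subdegree (fps_subst2 f \<phi>) < p * n"
    using ennreal_of_nat_divide_le_iff[OF q \<phi>(3), of p "subdegree (fps_subst2 f \<phi>)"]
    by (simp add: not_le[symmetric] mult.commute)
  then show ?thesis using that f(1) nz by blast
qed

text \<open>Along an arc of order n some f in \<open>\<aa>\<close> has q ord f < p n, while z has
  order at least p n. Stated for any \<open>I\<close> containing the q-th powers, to cover both an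
  enlargement of \<open>\<aa>\<close> with q = 1 and \<open>ideal_power \<aa> q\<close>.\<close>

lemma arc_dominated_if_lojasiewicz_less:
  fixes \<aa> :: "'k::field fps fps set"
  assumes less: "lojasiewicz_exponent \<aa> < of_nat p / of_nat q" and q: "0 < q"
    and I: "\<And>f. f \<in> \<aa> \<Longrightarrow> f ^ q \<in> I" and z: "z \<in> mpow p"
  shows "arc_dominated I z"
  unfolding arc_dominated_def
proof (intro allI impI)
  fix u v :: "'k fps" and d
  assume *: "u \<noteq> 0" "v \<noteq> 0" "u $ 0 = 0" "v $ 0 = 0" "\<forall>f\<in>I. fps_X ^ d dvd fps_subst2 f (u, v)"
  interpret arc "(u, v)" using * by unfold_locales auto
  have \<phi>: "(u, v) \<in> arcs" using * by (simp add: arcs_def)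
  then obtain n where n: "pair_ord (u, v) = enat n" "n > 0" "fps_X ^ n dvd u" "fps_X ^ n dvd v"
    by (rule arcsE) simp
  obtain f where f: "f \<in> \<aa>" "fps_subst2 f (u, v) \<noteq> 0" "q * subdegree (fps_subst2 f (u, v)) < p * n"
    using lojasiewicz_lessD[OF less q \<phi> n(1,2)] by blast
  have "fps_X ^ d dvd fps_subst2 f (u, v) ^ q"
    using *(5) I[OF f(1)] by (auto simp flip: subst.hom_power)
  then have "d \<le> n * p" using f(2,3) by (auto simp: fps_X_power_dvd_iff_subdegree mult.commute)
  moreover have "fps_X ^ (n * p) dvd fps_subst2 z (u, v)"
    using dvd_subst_if_mem_mpow[OF _ _ z, of "fps_X ^ n"] n(3,4) by (simp add: power_mult)
  ultimately show "fps_X ^ d dvd fps_subst2 z (u, v)"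
    using le_imp_power_dvd dvd_trans by blast
qed

text \<open>The arc criterion presupposes a power of (x, y) in the ideal, which is what has to be
  shown for \<open>\<aa>\<close>. Adding (x, y)^(p + 1) provides one, and its order is too high to
  affect the initial forms obtained.\<close>

lemma primary_if_lojasiewicz_finite:
  fixes \<aa> :: "'k::alg_closed_field fps fps set"
  assumes a: "is_ideal \<aa>" and fin: "lojasiewicz_exponent \<aa> < top_class.top"
  shows "\<exists>K. mpow K \<subseteq> \<aa>"
proof -
  obtain p where p: "lojasiewicz_exponent \<aa> < of_nat p"
    using ennreal_Ex_less_of_nat fin by auto
  let ?I = "add_sets \<aa> (mpow (Suc p))"
  have I: "is_ideal ?I" by (rule is_ideal_add_sets[OF a is_ideal_mpow])
  have sub: "mpow (Suc p) \<subseteq> ?I" using add_setsI[OF ideal_zeroI[OF a]] by fastforce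
  have init: "\<exists>N. \<exists>f\<in>\<aa>. z ^ N - f \<in> mpow (Suc (p * N))" if z: "z \<in> mpow p" for z
  proof -
    have "arc_dominated ?I z"
    proof (rule arc_dominated_if_lojasiewicz_less[OF _ _ _ z])
      show "lojasiewicz_exponent \<aa> < of_nat p / of_nat 1"
        using p divide_ennreal[of "real p" 1] by (simp add: ennreal_of_nat_eq_real_of_nat)
      show "f ^ 1 \<in> ?I" if "f \<in> \<aa>" for f
        using add_setsI[OF that ideal_zeroI[OF is_ideal_mpow]] by simp
    qed simp
    then have "z \<in> ideal_integral_closure ?I" by (rule integral_closure_if_arc_dominated[OF I sub])
    then show ?thesis by (rule initial_form_if_integral[OF a z])
  qed
  obtain N f M g where *: "f \<in> \<aa>" "(var_x ^ p) ^ N - f \<in> mpow (Suc (p * N))"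
    "g \<in> \<aa>" "(var_y ^ p) ^ M - g \<in> mpow (Suc (p * M))"
    using init[of "var_x ^ p"] init[of "var_y ^ p"] by (auto simp: var_power_mem_mpow_iff)
  have "mpow (p * N + p * M) \<subseteq> \<aa>"
    by (rule mpow_subset_if_initial_forms[OF a *(1,3)]) (use * in \<open>simp_all add: power_mult\<close>)
  then show ?thesis by blast
qed

lemma integral_if_lojasiewicz_less:
  fixes \<aa> :: "'k::alg_closed_field fps fps set"
  assumes a: "is_ideal \<aa>" and less: "lojasiewicz_exponent \<aa> < of_nat p / of_nat q" and q: "0 < q"
  shows "ideal_power (ideal_gen {var_x, var_y}) p \<subseteq> ideal_integral_closure (ideal_power \<aa> q)"
proof
  fix z :: "'k fps fps" assume z: "z \<in> ideal_power (ideal_gen {var_x, var_y}) p"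
  have "ideal_gen {var_x, var_y} \<subseteq> (mpow 1 :: 'k fps fps set)"
    by (rule ideal_gen_least[OF is_ideal_mpow]) (use vars_mem_mpow in auto)
  then have z': "z \<in> mpow p" using ideal_power_subset_mpow[of _ 1 p] z by auto
  have "lojasiewicz_exponent \<aa> < top_class.top" using less by (rule less_le_trans) simp
  then obtain K where "mpow K \<subseteq> \<aa>" using primary_if_lojasiewicz_finite[OF a] by blast
  then have "mpow (K * q) \<subseteq> ideal_power \<aa> q" by (rule mpow_subset_ideal_power[OF a])
  moreover have "arc_dominated (ideal_power \<aa> q) z"
    by (rule arc_dominated_if_lojasiewicz_less[OF less q power_mem_ideal_power z'])
  ultimately show "z \<in> ideal_integral_closure (ideal_power \<aa> q)"
    by (rule integral_closure_if_arc_dominated[OF is_ideal_power])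
qed

theorem theorem1:
  fixes \<aa> :: "'k::alg_closed_field fps fps set"
  assumes "is_ideal \<aa>"
  shows "lojasiewicz_exponent \<aa> =
    Inf {of_nat p / of_nat q :: ennreal | p q :: nat.
      0 < p \<and> 0 < q \<and>
      ideal_power (ideal_gen {var_x, var_y}) p \<subseteq> ideal_integral_closure (ideal_power \<aa> q)}"
    (is "?L = Inf ?S")
proof (rule antisym)
  show "?L \<le> Inf ?S"
    by (rule Inf_greatest) (auto intro: lojasiewicz_le_if_integral)
  show "Inf ?S \<le> ?L"
  proof (rule ccontr)
    assume "\<not> Inf ?S \<le> ?L"
    then have "?L < Inf ?S" by simp
    \<comment> \<open>Leaves room for a rational p/q strictly above the exponent and still below the
      infimum; integrality is available for strict upper bounds.\<close>
    then obtain y where y: "?L < y" "y < Inf ?S" using dense by blast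
    obtain l where l: "?L = ennreal l" "l \<ge> 0" using y(1) by (cases ?L) (auto simp: top_unique)
    obtain t where t: "y = ennreal t" "t \<ge> 0" using y(2) by (cases y) (auto simp: top_unique)
    have "l < t" using y(1) l t by (simp add: ennreal_less_iff)
    then obtain x where x: "x \<in> \<rat>" "l < x" "x < t" using Rats_dense_in_real by blast
    then have "x > 0" using l(2) by simp
    then obtain p q :: nat where pq: "q \<noteq> 0" "x = real p / real q"
      using Rats_abs_nat_div_natE[OF x(1)] by (metis abs_of_pos)
    then have x_eq: "ennreal x = of_nat p / of_nat q"
      by (simp add: ennreal_of_nat_eq_real_of_nat divide_ennreal)
    have "p > 0" using pq \<open>x > 0\<close> by (cases p) auto
    have "?L < of_nat p / of_nat q" unfolding x_eq[symmetric] l(1) using x l by (simp add: ennreal_less_iff)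
    then have "of_nat p / of_nat q \<in> ?S"
      using integral_if_lojasiewicz_less[OF assms] pq(1) \<open>p > 0\<close> by blast
    then have "Inf ?S \<le> ennreal x" unfolding x_eq by (rule Inf_lower)
    also have "\<dots> < y" using x l t by (simp add: ennreal_less_iff)
    finally show False using y(2) by simp
  qed
qed

end
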